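(* Let $X$ and $Y$ be biregular real algebraic sets (i.e. there is a biregular isomorphism between them). Then $X^{w_c}$ is biregular to $Y^{w_c}$, and $X^{s_c}$ is biregular to $Y^{s_c}$.
   Context: A real algebraic set is the zero set $X\subset\mathbb R^n$ of a family of polynomials; $\mathcal P(X)=\mathbb R[x_1,\dots,x_n]/\mathcal I(X)$ is its ring of polynomial functions and $\mathcal K(X)$ is the total ring of fractions of $\mathcal P(X)$. A rational function is regular on a Zariski-dense open $U\subset X$ if it equals $p/q$ on $U$ with $p,q$ polynomials and $q$ nowhere zero on $U$; $\mathcal O(X)$ is the ring of regular functions on the whole of $X$. A biregular isomorphism is a bijective map whose components are regular functions and whose inverse also has regular components (equivalently it induces an isomorphism of the rings of regular functions). If $X$ is irreducible, $\mathrm{Cent}\,X$ is the Euclidean closure in $X$ of the set of nonsingular points of $X$; if $X$ has irreducible components $X_1,\dots,X_t$, $\mathrm{Cent}\,X=\bigcup_i\mathrm{Cent}\,X_i$. An irreducible algebraic subset $V\subset X$ is central in $X$ if the Zariski closure of $V\cap\mathrm{Cent}\,X$ is $V$. $\mathcal K^0(\mathrm{Cent}\,X)$ is the ring of continuous functions $f:\mathrm{Cent}\,X\to\mathbb R$ for which there are a Zariski-dense open $U\subset X$ and a regular function $g$ on $U$ with $f=g$ on $U\cap\mathrm{Cent}\,X$; it injects canonically in $\mathcal K(X)$. $\mathcal R^0(\mathrm{Cent}\,X)$ is the subring of those $f\in\mathcal K^0(\mathrm{Cent}\,X)$ such that for every irreducible algebraic subset $V$ central in $X$ there are a Zariski-dense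 open $W\subset V$ and a rational function $g$ on $V$, regular on $W$, with $f=g$ on $W\cap\mathrm{Cent}\,X$. $X^{w_c}$ (resp. $X^{s_c}$), the weak-normalization (resp. seminormalization) of $X$ relative to its central locus, is the real algebraic set whose ring of polynomial functions is the integral closure of $\mathcal P(X)$ in $\mathcal K^0(\mathrm{Cent}\,X)$ (resp. in $\mathcal R^0(\mathrm{Cent}\,X)$). *)

theory Defs
  imports "HOL-Analysis.Analysis" "HOL-Algebra.QuotRing"
begin

section \<open>Real algebraic sets and the Zariski topology\<close>

definition real_algebraic_set :: "(real ^ 'n) set \<Rightarrow> bool" where
  "real_algebraic_set X \<longleftrightarrow>
     (\<exists>F. (\<forall>p\<in>F. real_polynomial_function p) \<and> X = {x. \<forall>p\<in>F. p x = 0})"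

definition zariski :: "(real ^ 'n) topology" where
  "zariski = topology (\<lambda>U. real_algebraic_set (- U))"

lemma real_algebraic_set_Un:
  assumes "real_algebraic_set X" "real_algebraic_set Y"
  shows "real_algebraic_set (X \<union> Y)"
proof -
  from assms obtain F G
    where F: "\<forall>p\<in>F. real_polynomial_function p" "X = {x. \<forall>p\<in>F. p x = 0}"
      and G: "\<forall>p\<in>G. real_polynomial_function p" "Y = {x. \<forall>p\<in>G. p x = 0}"
    unfolding real_algebraic_set_def by blast
  let ?H = "{\<lambda>x. p x * q x | p q. p \<in> F \<and> q \<in> G}"
  have "\<forall>h\<in>?H. real_polynomial_function h"
    using F(1) G(1) by (auto intro: real_polynomial_function.intros(4))
  moreover have "X \<union> Y = {x. \<forall>h\<in>?H. h x = 0}"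
  proof (intro Set.set_eqI iffI)
    fix x assume "x \<in> X \<union> Y"
    then show "x \<in> {x. \<forall>h\<in>?H. h x = 0}"
      unfolding F(2) G(2) by auto
  next
    fix x assume x: "x \<in> {x. \<forall>h\<in>?H. h x = 0}"
    have *: "p x * q x = 0" if "p \<in> F" "q \<in> G" for p q
    proof -
      have "(\<lambda>x. p x * q x) \<in> ?H"
        using that by blast
      then show ?thesis
        using x by fastforce
    qed
    show "x \<in> X \<union> Y"
    proof (cases "\<forall>p\<in>F. p x = 0")
      case False
      then obtain p where "p \<in> F" "p x \<noteq> 0"
        by blast
      with * have "\<forall>q\<in>G. q x = 0"
        by (metis mult_eq_0_iff)
      then show ?thesis
        unfolding G(2) by blast
    qed (simp add: F(2))
  qed
  ultimately show ?thesis
    unfolding real_algebraic_set_def by blast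
qed

lemma real_algebraic_set_Inter:
  assumes "\<And>X. X \<in> \<X> \<Longrightarrow> real_algebraic_set X"
  shows "real_algebraic_set (\<Inter>\<X>)"
proof -
  from assms have "\<forall>X\<in>\<X>. \<exists>F. (\<forall>p\<in>F. real_polynomial_function p) \<and> X = {x. \<forall>p\<in>F. p x = 0}"
    unfolding real_algebraic_set_def by blast
  from bchoice[OF this] obtain F
    where F: "\<forall>X\<in>\<X>. (\<forall>p\<in>F X. real_polynomial_function p) \<and> X = {x. \<forall>p\<in>F X. p x = 0}" ..
  have "\<Inter>\<X> = {x. \<forall>p\<in>(\<Union>X\<in>\<X>. F X). p x = 0}"
    using F by blast
  moreover have "\<forall>p\<in>(\<Union>X\<in>\<X>. F X). real_polynomial_function p"
    using F by blast
  ultimately show ?thesis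
    unfolding real_algebraic_set_def by blast
qed

lemma istopology_zariski: "istopology (\<lambda>U. real_algebraic_set (- U))"
  unfolding istopology_def
proof (intro conjI allI impI)
  fix S T :: "(real ^ 'n) set"
  assume "real_algebraic_set (- S)" "real_algebraic_set (- T)"
  then show "real_algebraic_set (- (S \<inter> T))"
    by (simp add: real_algebraic_set_Un)
next
  fix K :: "(real ^ 'n) set set"
  assume "\<forall>S\<in>K. real_algebraic_set (- S)"
  then have "real_algebraic_set (\<Inter> (uminus ` K))"
    by (intro real_algebraic_set_Inter) auto
  moreover have "\<Inter> (uminus ` K) = - \<Union>K"
    by auto
  ultimately show "real_algebraic_set (- \<Union>K)"
    by simp
qed

lemma openin_zariski: "openin zariski U \<longleftrightarrow> real_algebraic_set (- U)"
  by (simp add: zariski_def istopology_zariski)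

lemma topspace_zariski: "topspace zariski = (UNIV :: (real ^ 'n) set)"
proof -
  have "real_algebraic_set (- (UNIV :: (real ^ 'n) set))"
    unfolding real_algebraic_set_def
    by (rule exI[of _ "{\<lambda>x. 1}"]) auto
  then have "openin zariski (UNIV :: (real ^ 'n) set)"
    unfolding openin_zariski .
  then show ?thesis
    using openin_subset by blast
qed

lemma closedin_zariski: "closedin zariski X \<longleftrightarrow> real_algebraic_set X"
proof -
  have "UNIV - X = - X"
    by blast
  then show ?thesis
    unfolding closedin_def topspace_zariski openin_zariski by simp
qed

definition zariski_dense_open :: "(real ^ 'n) set \<Rightarrow> (real ^ 'n) set \<Rightarrow> bool" where
  "zariski_dense_open X U \<longleftrightarrow>
     openin (subtopology zariski X) U \<and> subtopology zariski X closure_of U = X"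

definition irreducible_algebraic_set :: "(real ^ 'n) set \<Rightarrow> bool" where
  "irreducible_algebraic_set X \<longleftrightarrow>
     real_algebraic_set X \<and> X \<noteq> {} \<and>
     (\<forall>A B. real_algebraic_set A \<and> real_algebraic_set B \<and> X = A \<union> B \<longrightarrow> X = A \<or> X = B)"

definition irreducible_component :: "(real ^ 'n) set \<Rightarrow> (real ^ 'n) set \<Rightarrow> bool" where
  "irreducible_component X V \<longleftrightarrow>
     irreducible_algebraic_set V \<and> V \<subseteq> X \<and>
     (\<forall>V'. irreducible_algebraic_set V' \<and> V \<subseteq> V' \<and> V' \<subseteq> X \<longrightarrow> V' = V)"

text \<open>The dimension is the Krull dimension of the Zariski topology on \<open>X\<close>.\<close>

definition zariski_dim :: "(real ^ 'n) set \<Rightarrow> enat" where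
  "zariski_dim X =
     Sup {enat k | k. \<exists>V :: nat \<Rightarrow> (real ^ 'n) set.
       (\<forall>i\<le>k. irreducible_algebraic_set (V i) \<and> V i \<subseteq> X) \<and> (\<forall>i<k. V i \<subset> V (Suc i))}"

section \<open>Regular functions and biregular isomorphisms\<close>

text \<open>
  Only the values of \<open>g\<close> on \<open>U\<close> matter. If \<open>U\<close> is Zariski-dense and open in \<open>X\<close>, such a \<open>g\<close>
  is a rational function on \<open>X\<close> that is regular on \<open>U\<close>.
\<close>

definition regular_on :: "(real ^ 'n) set \<Rightarrow> (real ^ 'n \<Rightarrow> real) \<Rightarrow> bool" where
  "regular_on U g \<longleftrightarrow>
     (\<exists>p q. real_polynomial_function p \<and> real_polynomial_function q \<and>
        (\<forall>x\<in>U. q x \<noteq> 0 \<and> g x = p x / q x))"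

definition biregular :: "(real ^ 'n) set \<Rightarrow> (real ^ 'm) set \<Rightarrow> bool" where
  "biregular X Y \<longleftrightarrow>
     (\<exists>f. bij_betw f X Y \<and>
        (\<forall>i. regular_on X (\<lambda>x. f x $ i)) \<and>
        (\<forall>j. regular_on Y (\<lambda>y. inv_into X f y $ j)))"

section \<open>The central locus\<close>

text \<open>
  Jacobian criterion for irreducible \<open>X\<close>: the rank at \<open>x\<close> of the Jacobian matrix of generators of
  the vanishing ideal is \<open>n - dim X\<close>. By the Leibniz rule the rows of that matrix have the same
  span as the gradients at \<open>x\<close> of all members of the ideal.
\<close>

definition nonsingular_points :: "(real ^ 'n) set \<Rightarrow> (real ^ 'n) set" where
  "nonsingular_points X =
     {x \<in> X. enat (dim {D. \<exists>p. real_polynomial_function p \<and> (\<forall>y\<in>X. p y = 0) \<and> GDERIV p x :> D})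
              + zariski_dim X = enat CARD('n)}"

definition Cent :: "(real ^ 'n) set \<Rightarrow> (real ^ 'n) set" where
  "Cent X = (\<Union>V \<in> {V. irreducible_component X V}. V \<inter> closure (nonsingular_points V))"

definition central_in :: "(real ^ 'n) set \<Rightarrow> (real ^ 'n) set \<Rightarrow> bool" where
  "central_in X V \<longleftrightarrow>
     irreducible_algebraic_set V \<and> V \<subseteq> X \<and> zariski closure_of (V \<inter> Cent X) = V"

section \<open>Rings of functions\<close>

text \<open>
  A function on \<open>S\<close> is represented by its \<^const>\<open>extensional\<close> extension, so that equality of
  functions on \<open>S\<close> is equality in HOL.
\<close>

definition fun_ring :: "'a set \<Rightarrow> ('a \<Rightarrow> real) set \<Rightarrow> ('a \<Rightarrow> real) ring" where
  "fun_ring S A =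
     \<lparr>carrier = A,
      monoid.mult = (\<lambda>f g. \<lambda>x\<in>S. f x * g x), one = (\<lambda>x\<in>S. 1),
      zero = (\<lambda>x\<in>S. 0), add = (\<lambda>f g. \<lambda>x\<in>S. f x + g x)\<rparr>"

definition polynomials_on :: "(real ^ 'n) set \<Rightarrow> (real ^ 'n \<Rightarrow> real) set" where
  "polynomials_on S = {restrict p S | p. real_polynomial_function p}"

definition poly_ring_of :: "(real ^ 'n) set \<Rightarrow> (real ^ 'n \<Rightarrow> real) ring" where
  "poly_ring_of X = fun_ring X (polynomials_on X)"

definition K0_Cent :: "(real ^ 'n) set \<Rightarrow> (real ^ 'n \<Rightarrow> real) ring" where
  "K0_Cent X = fun_ring (Cent X)
     {f \<in> extensional (Cent X). continuous_on (Cent X) f \<and>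
        (\<exists>U g. zariski_dense_open X U \<and> regular_on U g \<and> (\<forall>x \<in> U \<inter> Cent X. f x = g x))}"

definition R0_Cent :: "(real ^ 'n) set \<Rightarrow> (real ^ 'n \<Rightarrow> real) ring" where
  "R0_Cent X = fun_ring (Cent X)
     {f \<in> carrier (K0_Cent X). \<forall>V. central_in X V \<longrightarrow>
        (\<exists>W g. zariski_dense_open V W \<and> regular_on W g \<and> (\<forall>x \<in> W \<inter> Cent X. f x = g x))}"

definition integral_closure :: "'a set \<Rightarrow> ('a, 'b) ring_scheme \<Rightarrow> ('a, 'b) ring_scheme" where
  "integral_closure A R = R\<lparr>carrier :=
     {f \<in> carrier R. \<exists>n. \<exists>c \<in> {..<n} \<rightarrow> A.
        f [^]\<^bsub>R\<^esub> (n::nat) \<oplus>\<^bsub>R\<^esub> (\<Oplus>\<^bsub>R\<^esub>i\<in>{..<n}. c i \<otimes>\<^bsub>R\<^esub> f [^]\<^bsub>R\<^esub> i) = \<zero>\<^bsub>R\<^esub>}\<rparr>"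

text \<open>Isomorphism of rings of functions on \<open>S\<close> and on \<open>T\<close>, as algebras over the reals.\<close>

definition real_algebra_iso ::
  "'a set \<Rightarrow> ('a \<Rightarrow> real) ring \<Rightarrow> 'b set \<Rightarrow> ('b \<Rightarrow> real) ring \<Rightarrow> bool" where
  "real_algebra_iso S R T R' \<longleftrightarrow>
     (\<exists>h \<in> ring_iso R R'. \<forall>c::real. h (\<lambda>x\<in>S. c) = (\<lambda>x\<in>T. c))"

section \<open>Weak-normalization and seminormalization relative to the central locus\<close>

text \<open>
  These constructions determine a real algebraic set only up to isomorphism (and in an
  unspecified affine space), hence they are predicates: \<open>Z\<close> is a model of \<open>X\<^sup>w\<close>, respectively \<open>X\<^sup>s\<close>.
  The ring of polynomial functions of \<open>X\<close> sits in the rings of functions on \<open>Cent X\<close> by restriction.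
\<close>

definition is_central_weak_normalization :: "(real ^ 'n) set \<Rightarrow> (real ^ 'k) set \<Rightarrow> bool" where
  "is_central_weak_normalization X Z \<longleftrightarrow>
     real_algebraic_set Z \<and>
     real_algebra_iso Z (poly_ring_of Z)
       (Cent X) (integral_closure (polynomials_on (Cent X)) (K0_Cent X))"

definition is_central_seminormalization :: "(real ^ 'n) set \<Rightarrow> (real ^ 'k) set \<Rightarrow> bool" where
  "is_central_seminormalization X Z \<longleftrightarrow>
     real_algebraic_set Z \<and>
     real_algebra_iso Z (poly_ring_of Z)
       (Cent X) (integral_closure (polynomials_on (Cent X)) (R0_Cent X))"

end

theory Submission
  imports Defs
begin

text \<open>
  Let \<open>f : X \<rightarrow> Y\<close> be a biregular isomorphism with inverse \<open>g\<close>. Two things have to be seen.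
  
  First, \<open>f\<close> carries everything from which the rings of continuous rational functions are built. It is
  a homeomorphism for the Zariski topologies and for the Euclidean ones, because preimages of closed
  sets are closed after clearing denominators and because fractions are continuous. Hence it respects
  irreducible components, dimensions and Zariski-dense open sets. Its derivative identifies the Zariski
  tangent spaces, so it respects nonsingular points, and therefore \<open>f ` Cent X = Cent Y\<close>
  (\<open>Cent_image\<close>). Consequently \<open>u \<mapsto> u \<circ> f\<close> maps \<open>K0_Cent Y\<close> to \<open>K0_Cent X\<close> and \<open>R0_Cent Y\<close> to
  \<open>R0_Cent X\<close>.
  
  Second, the two integral closures, \<open>A\<close> over \<open>X\<close> and \<open>B\<close> over \<open>Y\<close>, need not correspond under this
  map, since \<open>f\<close> pulls polynomials back only to fractions. They do correspond after inverting the
  polynomials without zeros on \<open>X\<close> and on \<open>Y\<close>: a common denominator \<open>e\<close> of the pulled back coefficients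
  of a monic equation for \<open>b\<close> makes \<open>e \<cdot> (b \<circ> f)\<close> integral (\<open>integral_pullback\<close>). This is enough,
  because inverting these polynomials creates and destroys no real points. If \<open>Z\<close> is an algebraic set
  with ring of polynomial functions \<open>A\<close>, the points of \<open>Z\<close> are the unital real characters of \<open>A\<close>
  (\<open>character_is_ev\<close>). Restricted to polynomials, a character is evaluation at some point, and this point
  lies in \<open>X\<close> as \<open>X\<close> is closed; so a polynomial without zeros on \<open>X\<close> is sent to a nonzero number
  (\<open>character_denominator\<close>), and the character extends uniquely to the localization of \<open>A\<close>
  (\<open>character_extend\<close>). Composing with the pullback gives a character of \<open>B\<close>, that is a point of the
  algebraic set \<open>W\<close> of \<open>B\<close>. The map \<open>Z \<rightarrow> W\<close> obtained in this way is inverted by the one that comes from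
  \<open>g\<close>, and each of its coordinates is the value of an extended character at one fixed fraction, hence a
  quotient of two polynomial functions on \<open>Z\<close> (\<open>transport_regular\<close>).
\<close>

section \<open>Functions regular in a Zariski neighbourhood\<close>

lemma real_polynomial_function_differentiable:
  "real_polynomial_function p \<Longrightarrow> p differentiable (at x)"
  by (induction rule: real_polynomial_function.induct)
    (auto intro: differentiable_add differentiable_mult bounded_linear_imp_differentiable)

lemma open_polynomial_nonzero: "real_polynomial_function b \<Longrightarrow> open {x. b x \<noteq> 0}"
  by (intro open_Collect_neq continuous_at_imp_continuous_on)
    (auto intro: continuous_real_polymonial_function)

text \<open>
  In contrast to \<open>regular_on\<close>, the fraction represents \<open>\<phi>\<close> wherever its denominator is nonzero. This
  contains a Euclidean neighbourhood of every point of \<open>X\<close>, so that \<open>\<phi>\<close> has a derivative there.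
\<close>

definition regular_near :: "(real ^ 'n) set \<Rightarrow> (real ^ 'n \<Rightarrow> real) \<Rightarrow> bool" where
  "regular_near X \<phi> \<longleftrightarrow>
     (\<exists>a b. real_polynomial_function a \<and> real_polynomial_function b \<and>
        (\<forall>x\<in>X. b x \<noteq> 0) \<and> (\<forall>x. b x \<noteq> 0 \<longrightarrow> \<phi> x = a x / b x))"

lemma regular_nearI:
  assumes "real_polynomial_function a" "real_polynomial_function b"
    and "\<And>x. x \<in> X \<Longrightarrow> b x \<noteq> 0" "\<And>x. b x \<noteq> 0 \<Longrightarrow> \<phi> x = a x / b x"
  shows "regular_near X \<phi>"
  using assms unfolding regular_near_def by blast

lemma regular_nearE:
  assumes "regular_near X \<phi>"
  obtains a b where "real_polynomial_function a" "real_polynomial_function b"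
    "\<And>x. x \<in> X \<Longrightarrow> b x \<noteq> 0" "\<And>x. b x \<noteq> 0 \<Longrightarrow> \<phi> x = a x / b x"
  using assms unfolding regular_near_def by blast

lemma regular_near_mono: "regular_near X \<phi> \<Longrightarrow> U \<subseteq> X \<Longrightarrow> regular_near U \<phi>"
  unfolding regular_near_def by blast

lemma regular_near_polynomial: "real_polynomial_function p \<Longrightarrow> regular_near X p"
  by (rule regular_nearI[of p "\<lambda>x. 1"]) auto

lemma regular_near_add:
  assumes "regular_near X \<phi>" "regular_near X \<psi>"
  shows "regular_near X (\<lambda>x. \<phi> x + \<psi> x)"
proof -
  obtain a b where ab: "real_polynomial_function a" "real_polynomial_function b"
    "\<And>x. x \<in> X \<Longrightarrow> b x \<noteq> 0" "\<And>x. b x \<noteq> 0 \<Longrightarrow> \<phi> x = a x / b x"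
    using assms(1) by (rule regular_nearE) blast
  obtain c d where cd: "real_polynomial_function c" "real_polynomial_function d"
    "\<And>x. x \<in> X \<Longrightarrow> d x \<noteq> 0" "\<And>x. d x \<noteq> 0 \<Longrightarrow> \<psi> x = c x / d x"
    using assms(2) by (rule regular_nearE) blast
  show ?thesis
    by (rule regular_nearI[of "\<lambda>x. a x * d x + c x * b x" "\<lambda>x. b x * d x"])
      (use ab cd in \<open>auto simp: add_frac_eq\<close>)
qed

lemma regular_near_mult:
  assumes "regular_near X \<phi>" "regular_near X \<psi>"
  shows "regular_near X (\<lambda>x. \<phi> x * \<psi> x)"
proof -
  obtain a b where ab: "real_polynomial_function a" "real_polynomial_function b"
    "\<And>x. x \<in> X \<Longrightarrow> b x \<noteq> 0" "\<And>x. b x \<noteq> 0 \<Longrightarrow> \<phi> x = a x / b x"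
    using assms(1) by (rule regular_nearE) blast
  obtain c d where cd: "real_polynomial_function c" "real_polynomial_function d"
    "\<And>x. x \<in> X \<Longrightarrow> d x \<noteq> 0" "\<And>x. d x \<noteq> 0 \<Longrightarrow> \<psi> x = c x / d x"
    using assms(2) by (rule regular_nearE) blast
  show ?thesis
    by (rule regular_nearI[of "\<lambda>x. a x * c x" "\<lambda>x. b x * d x"])
      (use ab cd in auto)
qed

lemma regular_near_sum:
  assumes "finite I" "\<And>i. i \<in> I \<Longrightarrow> regular_near X (\<phi> i)"
  shows "regular_near X (\<lambda>x. \<Sum>i\<in>I. \<phi> i x)"
  using assms
proof (induction I)
  case empty
  show ?case
    by (simp add: regular_near_polynomial real_polynomial_function.intros(2))
next
  case (insert i I)
  then have "regular_near X (\<lambda>x. \<phi> i x + (\<Sum>i\<in>I. \<phi> i x))"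
    by (intro regular_near_add) simp_all
  then show ?case
    using insert(1,2) by simp
qed

lemma bounded_linear_coordinates:
  fixes p :: "real ^ 'n \<Rightarrow> real"
  assumes "bounded_linear p"
  shows "p y = (\<Sum>j\<in>UNIV. y $ j * p (axis j 1))"
proof -
  have "p y = p (\<Sum>j\<in>UNIV. y $ j *\<^sub>R axis j 1)"
    by (simp add: basis_expansion flip: scalar_mult_eq_scaleR)
  also have "\<dots> = (\<Sum>j\<in>UNIV. y $ j * p (axis j 1))"
    using assms by (simp add: linear_sum linear_scale bounded_linear.linear)
  finally show ?thesis .
qed

lemma regular_near_polynomial_compose:
  assumes f: "\<And>j. regular_near X (\<lambda>x. f x $ j)" and p: "real_polynomial_function p"
  shows "regular_near X (\<lambda>x. p (f x))"
  using p
proof induction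
  case (linear p)
  have "p (f x) = (\<Sum>j\<in>UNIV. f x $ j * p (axis j 1))" for x
    using linear by (rule bounded_linear_coordinates)
  then show ?case
    by (auto intro!: regular_near_sum regular_near_mult f intro: regular_near_polynomial)
qed (auto intro: regular_near_add regular_near_mult regular_near_polynomial)

lemma regular_near_compose:
  assumes f: "\<And>j. regular_near X (\<lambda>x. f x $ j)" and "f ` X \<subseteq> Y" and "regular_near Y \<phi>"
  shows "regular_near X (\<lambda>x. \<phi> (f x))"
proof -
  obtain a b where ab: "real_polynomial_function a" "real_polynomial_function b"
    "\<And>x. x \<in> Y \<Longrightarrow> b x \<noteq> 0" "\<And>x. b x \<noteq> 0 \<Longrightarrow> \<phi> x = a x / b x"
    using assms(3) by (rule regular_nearE) blast
  obtain a1 a2 where a: "real_polynomial_function a1" "real_polynomial_function a2"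
    "\<And>x. x \<in> X \<Longrightarrow> a2 x \<noteq> 0" "\<And>x. a2 x \<noteq> 0 \<Longrightarrow> a (f x) = a1 x / a2 x"
    using regular_near_polynomial_compose[OF f ab(1)] by (rule regular_nearE) blast
  obtain b1 b2 where b: "real_polynomial_function b1" "real_polynomial_function b2"
    "\<And>x. x \<in> X \<Longrightarrow> b2 x \<noteq> 0" "\<And>x. b2 x \<noteq> 0 \<Longrightarrow> b (f x) = b1 x / b2 x"
    using regular_near_polynomial_compose[OF f ab(2)] by (rule regular_nearE) blast
  have b1: "b1 x \<noteq> 0" if "x \<in> X" for x
    using ab(3)[of "f x"] b(3,4)[of x] assms(2) that by auto
  \<comment> \<open>The factor \<open>b2\<close> keeps out the points where the fraction for \<open>b \<circ> f\<close> is not valid.\<close>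
  have eq: "\<phi> (f x) = (a1 x * b2 x * b2 x) / (a2 x * b1 x * b2 x)"
    if "a2 x * b1 x * b2 x \<noteq> 0" for x
    using that a(4)[of x] b(4)[of x] ab(4)[of "f x"] by simp
  show ?thesis
    by (rule regular_nearI[of "\<lambda>x. a1 x * b2 x * b2 x" "\<lambda>x. a2 x * b1 x * b2 x"])
      (use a(1-3) b(1-3) b1 eq in auto)
qed

lemma regular_near_imp_regular_on: "regular_near X \<phi> \<Longrightarrow> regular_on X \<phi>"
  unfolding regular_near_def regular_on_def by blast

text \<open>
  The values of \<open>u\<close> off \<open>X\<close> are arbitrary; they are replaced by those of the fraction.
\<close>

lemma regular_on_imp_regular_near:
  assumes "regular_on X u"
  obtains \<phi> where "regular_near X \<phi>" "\<And>x. x \<in> X \<Longrightarrow> \<phi> x = u x"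
proof -
  obtain a b where ab: "real_polynomial_function a" "real_polynomial_function b"
    "\<forall>x\<in>X. b x \<noteq> 0 \<and> u x = a x / b x"
    using assms unfolding regular_on_def by blast
  show ?thesis
    by (rule that[of "\<lambda>x. a x / b x"]) (use ab in \<open>auto intro: regular_nearI[of a b]\<close>)
qed

lemma regular_on_cong:
  "regular_on X u \<Longrightarrow> (\<And>x. x \<in> X \<Longrightarrow> v x = u x) \<Longrightarrow> regular_on X v"
  unfolding regular_on_def by metis

lemma regular_on_mono: "regular_on X u \<Longrightarrow> U \<subseteq> X \<Longrightarrow> regular_on U u"
  unfolding regular_on_def by blast

lemma regular_on_compose:
  assumes f: "\<And>j. regular_near U (\<lambda>x. f x $ j)" and "f ` U \<subseteq> W" and "regular_on W u"
  shows "regular_on U (\<lambda>x. u (f x))"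
proof -
  obtain \<phi> where "regular_near W \<phi>" "\<And>x. x \<in> W \<Longrightarrow> \<phi> x = u x"
    using assms(3) by (rule regular_on_imp_regular_near) blast
  then have "regular_on U (\<lambda>x. \<phi> (f x))"
    using regular_near_compose[OF f assms(2)] by (blast intro: regular_near_imp_regular_on)
  then show ?thesis
    by (rule regular_on_cong) (use \<open>\<And>x. x \<in> W \<Longrightarrow> \<phi> x = u x\<close> assms(2) in auto)
qed

lemma regular_near_differentiable:
  assumes "regular_near X \<phi>" "x \<in> X"
  shows "\<phi> differentiable (at x)"
proof -
  obtain a b where ab: "real_polynomial_function a" "real_polynomial_function b"
    "\<And>x. x \<in> X \<Longrightarrow> b x \<noteq> 0" "\<And>x. b x \<noteq> 0 \<Longrightarrow> \<phi> x = a x / b x"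
    using assms(1) by (rule regular_nearE) blast
  have d: "a differentiable (at x)" "b differentiable (at x)"
    using ab(1,2) by (auto intro: real_polynomial_function_differentiable)
  have "(\<lambda>x. a x / b x) differentiable (at x)"
    using d ab(3)[OF assms(2)] by (rule differentiable_divide)
  then obtain D where D: "((\<lambda>x. a x / b x) has_derivative D) (at x)"
    unfolding differentiable_def by blast
  have "open {x. b x \<noteq> 0}"
    using ab(2) by (rule open_polynomial_nonzero)
  then have "(\<phi> has_derivative D) (at x)"
    using has_derivative_transform_within_open[OF D, of "{x. b x \<noteq> 0}" \<phi>] ab(3,4) assms(2)
    by simp
  then show ?thesis
    unfolding differentiable_def by blast
qed

lemma differentiable_vecI:
  fixes f :: "'a::real_normed_vector \<Rightarrow> real ^ 'm"
  assumes "\<And>j. (\<lambda>x. f x $ j) differentiable (at x)"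
  shows "f differentiable (at x)"
proof -
  obtain D where "\<And>j. ((\<lambda>x. f x $ j) has_derivative D j) (at x)"
    using assms unfolding differentiable_def by metis
  then have "(f has_derivative (\<lambda>h. \<chi> j. D j h)) (at x)"
    by (subst has_derivative_componentwise_within) (auto simp: Basis_vec_def inner_axis)
  then show ?thesis
    unfolding differentiable_def by blast
qed

section \<open>Zariski tangent spaces\<close>

text \<open>
  Derivatives are used as linear forms, not as gradient vectors, which makes the chain rule directly
  applicable.
\<close>

definition tangent_space :: "(real ^ 'n) set \<Rightarrow> real ^ 'n \<Rightarrow> (real ^ 'n) set" where
  "tangent_space V x =
     {v. \<forall>p p'. real_polynomial_function p \<and> (\<forall>y\<in>V. p y = 0) \<and> (p has_derivative p') (at x)
            \<longrightarrow> p' v = 0}"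

text \<open>
  The tangent space is the orthogonal complement of the gradients that occur in the Jacobian criterion.
\<close>

lemma dim_gradients_tangent_space:
  fixes V :: "(real ^ 'n) set"
  shows "dim {D. \<exists>p. real_polynomial_function p \<and> (\<forall>y\<in>V. p y = 0) \<and> GDERIV p x :> D}
     + dim (tangent_space V x) = CARD('n)" (is "dim ?G + _ = _")
proof -
  have "tangent_space V x = {v \<in> UNIV. \<forall>d\<in>span ?G. orthogonal d v}" (is "_ = ?R")
  proof (intro equalityI subsetI)
    fix v assume v: "v \<in> tangent_space V x"
    have "orthogonal v d" if "d \<in> ?G" for d
      using v that unfolding tangent_space_def gderiv_def orthogonal_def by blast
    then have "orthogonal v d" if "d \<in> span ?G" for d
      using orthogonal_to_span[OF that] by blast
    then show "v \<in> ?R"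
      by (simp add: orthogonal_commute)
  next
    fix v assume v: "v \<in> ?R"
    have "p' v = 0" if p: "real_polynomial_function p" "\<forall>y\<in>V. p y = 0"
      "(p has_derivative p') (at x)" for p p'
    proof -
      have "linear p'"
        using p(3) by (rule has_derivative_linear)
      then have eq: "p' h = h \<bullet> adjoint p' 1" for h
        using adjoint_works[of p' h 1] by simp
      then have "p' = (\<lambda>h. h \<bullet> adjoint p' 1)"
        by blast
      then have "adjoint p' 1 \<in> ?G"
        using p unfolding gderiv_def by auto
      then have "adjoint p' 1 \<in> span ?G"
        by (rule span_base)
      then have "orthogonal (adjoint p' 1) v"
        using v by simp
      then show ?thesis
        unfolding orthogonal_def eq[of v] by (simp add: inner_commute)
    qed
    then show "v \<in> tangent_space V x"
      unfolding tangent_space_def by blast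
  qed
  then show ?thesis
    using dim_subspace_orthogonal_to_vectors[of "span ?G" UNIV] by (simp add: add.commute)
qed

lemma subspace_tangent_space: "subspace (tangent_space V x)"
proof (rule subspaceI)
  show "0 \<in> tangent_space V x"
    unfolding tangent_space_def by (auto simp: linear_0 dest: has_derivative_linear)
next
  fix v w assume "v \<in> tangent_space V x" "w \<in> tangent_space V x"
  then show "v + w \<in> tangent_space V x"
    unfolding tangent_space_def mem_Collect_eq
    by (metis add.right_neutral has_derivative_linear linear_add)
next
  fix c :: real and v assume "v \<in> tangent_space V x"
  then show "c *\<^sub>R v \<in> tangent_space V x"
    unfolding tangent_space_def mem_Collect_eq
    by (metis has_derivative_linear linear_scale scaleR_zero_right)
qed

text \<open>
  Near \<open>x\<close> write \<open>\<phi> = a / b\<close>. The numerator \<open>a = \<phi> \<cdot> b\<close> vanishes on \<open>V\<close>, and \<open>\<phi> x = 0\<close> makes its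
  derivative at \<open>x\<close> equal to \<open>b x \<cdot> \<phi>'\<close>.
\<close>

lemma derivative_vanishes_on_tangent_space:
  assumes "regular_near V \<phi>" "\<And>y. y \<in> V \<Longrightarrow> \<phi> y = 0" "x \<in> V"
    and D: "(\<phi> has_derivative \<phi>') (at x)" and v: "v \<in> tangent_space V x"
  shows "\<phi>' v = 0"
proof -
  obtain a b where ab: "real_polynomial_function a" "real_polynomial_function b"
    "\<And>x. x \<in> V \<Longrightarrow> b x \<noteq> 0" "\<And>x. b x \<noteq> 0 \<Longrightarrow> \<phi> x = a x / b x"
    using assms(1) by (rule regular_nearE) blast
  have b_diff: "b differentiable (at x)"
    using ab(2) by (auto intro: real_polynomial_function_differentiable)
  then obtain b' where b': "(b has_derivative b') (at x)"
    unfolding differentiable_def by blast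
  have prod: "((\<lambda>y. \<phi> y * b y) has_derivative (\<lambda>h. \<phi> x * b' h + \<phi>' h * b x)) (at x)"
    by (rule has_derivative_mult[OF D b'])
  have "open {x. b x \<noteq> 0}"
    using ab(2) by (rule open_polynomial_nonzero)
  then have "(a has_derivative (\<lambda>h. \<phi> x * b' h + \<phi>' h * b x)) (at x)"
    using has_derivative_transform_within_open[OF prod, of "{x. b x \<noteq> 0}" a] ab(3,4) assms(3)
    by simp
  moreover have "\<forall>y\<in>V. a y = 0"
    using ab(3,4) assms(2) by (metis divide_eq_0_iff)
  ultimately have "\<phi> x * b' v + \<phi>' v * b x = 0"
    using v ab(1) unfolding tangent_space_def by blast
  then show ?thesis
    using assms(2)[OF assms(3)] ab(3)[OF assms(3)] by simp
qed

section \<open>The central locus under a biregular isomorphism\<close>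

lemma Cent_subset: "Cent X \<subseteq> X"
  unfolding Cent_def irreducible_component_def by auto

text \<open>
  A biregular isomorphism, given by maps on the whole space so that they can be differentiated. The
  assumptions are symmetric in \<open>f\<close> and \<open>g\<close>; each inclusion proved for \<open>f\<close> gives the converse one
  through \<open>swap\<close>.
\<close>

locale biregular_pair =
  fixes X :: "(real ^ 'n) set" and Y :: "(real ^ 'm) set" and f g
  assumes algebraic_X: "real_algebraic_set X" and algebraic_Y: "real_algebraic_set Y"
    and f_regular: "\<And>j. regular_near X (\<lambda>x. f x $ j)"
    and g_regular: "\<And>i. regular_near Y (\<lambda>y. g y $ i)"
    and f_in: "x \<in> X \<Longrightarrow> f x \<in> Y" and g_in: "y \<in> Y \<Longrightarrow> g y \<in> X"
    and gf: "x \<in> X \<Longrightarrow> g (f x) = x" and fg: "y \<in> Y \<Longrightarrow> f (g y) = y"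
begin

lemma swap: "biregular_pair Y X g f"
  using algebraic_X algebraic_Y f_regular g_regular f_in g_in gf fg
  unfolding biregular_pair_def by blast

text \<open>
  On \<open>X\<close> the function \<open>p \<circ> f\<close> vanishes exactly where the numerator of a fraction representing it does.
\<close>

lemma algebraic_preimage:
  assumes "real_algebraic_set V"
  shows "real_algebraic_set {x \<in> X. f x \<in> V}"
proof -
  obtain F where F: "\<forall>p\<in>F. real_polynomial_function p" "X = {x. \<forall>p\<in>F. p x = 0}"
    using algebraic_X unfolding real_algebraic_set_def by blast
  obtain G where G: "\<forall>p\<in>G. real_polynomial_function p" "V = {x. \<forall>p\<in>G. p x = 0}"
    using assms unfolding real_algebraic_set_def by blast
  have "\<forall>p\<in>G. \<exists>a. real_polynomial_function a \<and> (\<forall>x\<in>X. a x = 0 \<longleftrightarrow> p (f x) = 0)"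
  proof
    fix p assume "p \<in> G"
    then have "regular_near X (\<lambda>x. p (f x))"
      using G(1) f_regular by (blast intro: regular_near_polynomial_compose)
    then obtain a b where "real_polynomial_function a" "\<And>x. x \<in> X \<Longrightarrow> b x \<noteq> 0"
      "\<And>x. b x \<noteq> 0 \<Longrightarrow> p (f x) = a x / b x"
      by (rule regular_nearE) blast
    then show "\<exists>a. real_polynomial_function a \<and> (\<forall>x\<in>X. a x = 0 \<longleftrightarrow> p (f x) = 0)"
      by (intro exI[of _ a]) auto
  qed
  from bchoice[OF this] obtain num
    where num: "\<forall>p\<in>G. real_polynomial_function (num p) \<and> (\<forall>x\<in>X. num p x = 0 \<longleftrightarrow> p (f x) = 0)" ..
  have "{x \<in> X. f x \<in> V} = {x. \<forall>p\<in>F \<union> num ` G. p x = 0}"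
    using num F(2) G(2) by auto
  moreover have "\<forall>p\<in>F \<union> num ` G. real_polynomial_function p"
    using F(1) num by blast
  ultimately show ?thesis
    unfolding real_algebraic_set_def by blast
qed

lemma image_eq: "f ` X = Y"
  using f_in g_in fg by (metis image_iff subsetI subset_antisym image_subsetI)

lemma image_eq_preimage: "V \<subseteq> X \<Longrightarrow> f ` V = {y \<in> Y. g y \<in> V}"
  using f_in gf fg by (force simp: image_iff)

lemma inj_on_f: "inj_on f X"
  using gf by (metis inj_onI)

lemma algebraic_image:
  assumes "real_algebraic_set V" "V \<subseteq> X"
  shows "real_algebraic_set (f ` V)"
  unfolding image_eq_preimage[OF assms(2)]
  using biregular_pair.algebraic_preimage[OF swap assms(1)] .

text \<open>
  Thanks to this, facts about \<open>X\<close> itself can be used for its closed subsets, in particular for its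
  irreducible components and for central subsets.
\<close>

lemma restrict_pair:
  assumes "real_algebraic_set V" "V \<subseteq> X"
  shows "biregular_pair V (f ` V) f g"
proof
  show "regular_near V (\<lambda>x. f x $ j)" for j
    using f_regular assms(2) by (rule regular_near_mono)
  show "regular_near (f ` V) (\<lambda>y. g y $ i)" for i
    by (rule regular_near_mono[OF g_regular]) (use f_in assms(2) in auto)
qed (use assms algebraic_image gf in \<open>auto simp: subset_iff\<close>)

lemma irreducible_image:
  assumes "irreducible_algebraic_set V" "V \<subseteq> X"
  shows "irreducible_algebraic_set (f ` V)"
proof -
  have V: "real_algebraic_set V" "V \<noteq> {}"
    and irr: "\<And>A B. real_algebraic_set A \<Longrightarrow> real_algebraic_set B \<Longrightarrow> V = A \<union> B \<Longrightarrow> V = A \<or> V = B"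
    using assms(1) unfolding irreducible_algebraic_set_def by blast+
  interpret V: biregular_pair V "f ` V" f g
    using V(1) assms(2) by (rule restrict_pair)
  have "f ` V = A \<or> f ` V = B"
    if AB: "real_algebraic_set A" "real_algebraic_set B" "f ` V = A \<union> B" for A B
  proof -
    have "V = {x \<in> V. f x \<in> A} \<union> {x \<in> V. f x \<in> B}"
      using AB(3) by blast
    then have "V = {x \<in> V. f x \<in> A} \<or> V = {x \<in> V. f x \<in> B}"
      using AB by (intro irr V.algebraic_preimage)
    then show ?thesis
      using AB(3) by blast
  qed
  then show ?thesis
    using V(2) V.algebraic_Y unfolding irreducible_algebraic_set_def by blast
qed

lemma zariski_dim_le: "zariski_dim X \<le> zariski_dim Y"
proof -
  have image_chain: "\<exists>W. (\<forall>i\<le>k. irreducible_algebraic_set (W i) \<and> W i \<subseteq> Y) \<and> (\<forall>i<k. W i \<subset> W (Suc i))"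
    if V: "\<forall>i\<le>k. irreducible_algebraic_set (V i) \<and> V i \<subseteq> X" "\<forall>i<k. V i \<subset> V (Suc i)"
    for k :: nat and V :: "nat \<Rightarrow> (real ^ 'n) set"
  proof (intro exI[of _ "\<lambda>i. f ` V i"] conjI allI impI)
    fix i assume "i \<le> k"
    then show "irreducible_algebraic_set (f ` V i)" "f ` V i \<subseteq> Y"
      using V(1) irreducible_image f_in by blast+
  next
    fix i assume i: "i < k"
    then have "V i \<subset> V (Suc i)" "V (Suc i) \<subseteq> X"
      using V by auto
    then show "f ` V i \<subset> f ` V (Suc i)"
      using inj_on_image_eq_iff[OF inj_on_f, of "V i" "V (Suc i)"] by blast
  qed
  show ?thesis
    unfolding zariski_dim_def
    by (intro Sup_subset_mono Collect_mono impI, elim exE conjE)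
      (rule exI, rule conjI, assumption, rule image_chain, assumption+)
qed

lemma zariski_dim_eq: "zariski_dim X = zariski_dim Y"
  using zariski_dim_le biregular_pair.zariski_dim_le[OF swap] by (rule antisym)

lemma irreducible_component_image:
  assumes "irreducible_component X V"
  shows "irreducible_component Y (f ` V)"
proof -
  have V: "irreducible_algebraic_set V" "V \<subseteq> X"
    and max: "\<And>V'. irreducible_algebraic_set V' \<Longrightarrow> V \<subseteq> V' \<Longrightarrow> V' \<subseteq> X \<Longrightarrow> V' = V"
    using assms unfolding irreducible_component_def by auto
  have "V' = f ` V" if V': "irreducible_algebraic_set V'" "f ` V \<subseteq> V'" "V' \<subseteq> Y" for V'
  proof -
    have "g ` V' = V"
    proof (rule max)
      show "irreducible_algebraic_set (g ` V')"
        using biregular_pair.irreducible_image[OF swap V'(1,3)] .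
      show "V \<subseteq> g ` V'"
      proof
        fix x assume "x \<in> V"
        then have "f x \<in> V'" "g (f x) = x"
          using V(2) V'(2) gf by auto
        then show "x \<in> g ` V'"
          by (metis imageI)
      qed
      show "g ` V' \<subseteq> X"
        using V'(3) g_in by blast
    qed
    moreover have "f ` g ` V' = V'"
      using V'(3) fg by (force simp: image_iff)
    ultimately show ?thesis
      by simp
  qed
  moreover have "f ` V \<subseteq> Y"
    using V(2) f_in by blast
  ultimately show ?thesis
    using irreducible_image[OF V] unfolding irreducible_component_def by simp
qed

lemma f_differentiable: "x \<in> X \<Longrightarrow> f differentiable (at x)"
  by (rule differentiable_vecI) (rule regular_near_differentiable[OF f_regular])

text \<open>
  The derivative of \<open>f\<close> at \<open>x\<close> maps tangent vectors to tangent vectors because \<open>p \<circ> f\<close> vanishes on \<open>X\<close>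
  whenever \<open>p\<close> vanishes on \<open>Y\<close>. It is injective on them: the components of \<open>g \<circ> f - id\<close> vanish on
  \<open>X\<close>, so the derivative of \<open>g\<close> undoes it on tangent vectors.
\<close>

lemma dim_tangent_space_le:
  assumes x: "x \<in> X"
  shows "dim (tangent_space X x) \<le> dim (tangent_space Y (f x))"
proof -
  have "f differentiable (at x)"
    using x by (rule f_differentiable)
  then obtain f' where f': "(f has_derivative f') (at x)"
    unfolding differentiable_def by blast
  have "g differentiable (at (f x))"
    using biregular_pair.f_differentiable[OF swap f_in[OF x]] .
  then obtain g' where g': "(g has_derivative g') (at (f x))"
    unfolding differentiable_def by blast
  have sub: "f' ` tangent_space X x \<subseteq> tangent_space Y (f x)"
  proof (intro subsetI)
    fix w assume "w \<in> f' ` tangent_space X x"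
    then obtain v where v: "v \<in> tangent_space X x" "w = f' v"
      by blast
    have "p' w = 0" if p: "real_polynomial_function p" "\<forall>y\<in>Y. p y = 0"
      "(p has_derivative p') (at (f x))" for p p'
    proof -
      have "((\<lambda>y. p (f y)) has_derivative (\<lambda>h. p' (f' h))) (at x)"
        using has_derivative_compose[OF f' p(3)] .
      moreover have "regular_near X (\<lambda>y. p (f y))"
        using f_regular p(1) by (rule regular_near_polynomial_compose)
      ultimately show ?thesis
        using derivative_vanishes_on_tangent_space[of X "\<lambda>y. p (f y)"] p(2) f_in x v by auto
    qed
    then show "w \<in> tangent_space Y (f x)"
      unfolding tangent_space_def by blast
  qed
  have inv: "g' (f' v) = v" if v: "v \<in> tangent_space X x" for v
  proof -
    have "(g' (f' v) - v) $ i = 0" for i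
    proof -
      have *: "((\<lambda>y. g (f y) - y) has_derivative (\<lambda>h. g' (f' h) - h)) (at x)"
        by (intro has_derivative_diff has_derivative_compose[OF f' g'] has_derivative_ident)
      have deriv: "((\<lambda>y. (g (f y) - y) $ i) has_derivative (\<lambda>h. (g' (f' h) - h) $ i)) (at x)"
        using bounded_linear.has_derivative[OF bounded_linear_vec_nth *] .
      have "regular_near X (\<lambda>y. (g (f y) - y) $ i)"
      proof -
        have "real_polynomial_function (\<lambda>y :: real ^ 'n. - 1 * y $ i)"
          by (intro real_polynomial_function.intros(4,2,1) bounded_linear_vec_nth)
        then have "regular_near X (\<lambda>y. g (f y) $ i + - 1 * y $ i)"
          by (intro regular_near_add regular_near_polynomial
              regular_near_compose[OF f_regular _ g_regular]) (use f_in in auto)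
        then show ?thesis
          by simp
      qed
      then show ?thesis
        by (rule derivative_vanishes_on_tangent_space[OF _ _ x deriv v]) (simp add: gf)
    qed
    then show ?thesis
      by (simp add: vec_eq_iff)
  qed
  have "inj_on f' (span (tangent_space X x))"
    using inv by (metis inj_onI span_eq_iff subspace_tangent_space)
  then have "dim (f' ` tangent_space X x) = dim (tangent_space X x)"
    using f' by (intro dim_image_eq has_derivative_linear)
  then show ?thesis
    using dim_subset[OF sub] by simp
qed

text \<open>
  By \<open>dim_gradients_tangent_space\<close>, the Jacobian criterion says that the tangent space has the dimension
  of \<open>X\<close>, and both dimensions are preserved.
\<close>

lemma nonsingular_points_image: "f ` nonsingular_points X \<subseteq> nonsingular_points Y"
proof
  fix y assume "y \<in> f ` nonsingular_points X"
  then obtain x where x: "x \<in> nonsingular_points X" "y = f x"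
    by blast
  let ?G = "{D. \<exists>p. real_polynomial_function p \<and> (\<forall>y\<in>X. p y = 0) \<and> GDERIV p x :> D}"
  let ?H = "{D. \<exists>p. real_polynomial_function p \<and> (\<forall>y\<in>Y. p y = 0) \<and> GDERIV p (f x) :> D}"
  have xX: "x \<in> X" and G: "enat (dim ?G) + zariski_dim X = enat CARD('n)"
    using x(1) unfolding nonsingular_points_def by auto
  obtain d where d: "zariski_dim X = enat d"
    using G by (cases "zariski_dim X") auto
  have "dim ?G + d = CARD('n)"
    using G unfolding d plus_enat_simps enat.inject .
  then have "dim (tangent_space X x) = d"
    using dim_gradients_tangent_space[of X x] by linarith
  moreover have "dim (tangent_space Y (f x)) = dim (tangent_space X x)"
    using dim_tangent_space_le[OF xX] biregular_pair.dim_tangent_space_le[OF swap f_in[OF xX]]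
    unfolding gf[OF xX] by linarith
  ultimately have "dim ?H + d = CARD('m)"
    using dim_gradients_tangent_space[of Y "f x"] by linarith
  then have "enat (dim ?H) + zariski_dim Y = enat CARD('m)"
    unfolding zariski_dim_eq[symmetric] d plus_enat_simps enat.inject .
  then show "y \<in> nonsingular_points Y"
    unfolding nonsingular_points_def x(2) by (intro CollectI conjI f_in[OF xX])
qed

lemma f_isCont: "x \<in> X \<Longrightarrow> isCont f x"
  using differentiable_imp_continuous_within[OF f_differentiable] .

text \<open>
  Irreducible components go to irreducible components, their nonsingular points to nonsingular points,
  and Euclidean limits to Euclidean limits.
\<close>

lemma Cent_image_subset: "f ` Cent X \<subseteq> Cent Y"
proof
  fix y assume "y \<in> f ` Cent X"
  then obtain x where "y = f x" "x \<in> Cent X"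
    by blast
  then obtain V where x: "y = f x" "irreducible_component X V" "x \<in> V"
    "x \<in> closure (nonsingular_points V)"
    unfolding Cent_def by auto
  have V: "real_algebraic_set V" "V \<subseteq> X"
    using x(2) unfolding irreducible_component_def irreducible_algebraic_set_def by auto
  interpret V: biregular_pair V "f ` V" f g
    using V by (rule restrict_pair)
  obtain s where s: "\<And>n. s n \<in> nonsingular_points V" "s \<longlonglongrightarrow> x"
    using x(4) unfolding closure_sequential by blast
  have "(\<lambda>n. f (s n)) \<longlonglongrightarrow> f x"
    using V.f_isCont[OF x(3)] s(2) by (rule isCont_tendsto_compose)
  moreover have "f (s n) \<in> nonsingular_points (f ` V)" for n
    using s(1) V.nonsingular_points_image by blast
  ultimately have "f x \<in> closure (nonsingular_points (f ` V))"
    unfolding closure_sequential by (intro exI[of _ "\<lambda>n. f (s n)"]) auto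
  then show "y \<in> Cent Y"
    using irreducible_component_image[OF x(2)] x(1,3) unfolding Cent_def by auto
qed

lemma Cent_image: "f ` Cent X = Cent Y"
proof
  show "Cent Y \<subseteq> f ` Cent X"
  proof
    fix y assume y: "y \<in> Cent Y"
    then have "g y \<in> Cent X"
      using biregular_pair.Cent_image_subset[OF swap] by blast
    moreover have "y \<in> Y"
      using y unfolding Cent_def irreducible_component_def by auto
    ultimately show "y \<in> f ` Cent X"
      using fg by (metis image_eqI)
  qed
qed (rule Cent_image_subset)

end

section \<open>Generically regular functions\<close>

text \<open>
  The condition imposed on \<open>X\<close> in \<open>\<K>\<^sup>0\<close> and on every central subset of \<open>X\<close> in \<open>\<R>\<^sup>0\<close>.
\<close>

definition generically_regular ::
  "(real ^ 'n) set \<Rightarrow> (real ^ 'n) set \<Rightarrow> (real ^ 'n \<Rightarrow> real) \<Rightarrow> bool" where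
  "generically_regular V S u \<longleftrightarrow>
     (\<exists>W g. zariski_dense_open V W \<and> regular_on W g \<and> (\<forall>x \<in> W \<inter> S. u x = g x))"

lemma regular_on_add:
  assumes "regular_on U u" "regular_on U v"
  shows "regular_on U (\<lambda>x. u x + v x)"
proof -
  obtain \<phi> where \<phi>: "regular_near U \<phi>" "\<And>x. x \<in> U \<Longrightarrow> \<phi> x = u x"
    using assms(1) by (rule regular_on_imp_regular_near) blast
  obtain \<psi> where \<psi>: "regular_near U \<psi>" "\<And>x. x \<in> U \<Longrightarrow> \<psi> x = v x"
    using assms(2) by (rule regular_on_imp_regular_near) blast
  show ?thesis
    using regular_near_imp_regular_on[OF regular_near_add[OF \<phi>(1) \<psi>(1)]]
    by (rule regular_on_cong) (simp add: \<phi>(2) \<psi>(2))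
qed

lemma regular_on_mult:
  assumes "regular_on U u" "regular_on U v"
  shows "regular_on U (\<lambda>x. u x * v x)"
proof -
  obtain \<phi> where \<phi>: "regular_near U \<phi>" "\<And>x. x \<in> U \<Longrightarrow> \<phi> x = u x"
    using assms(1) by (rule regular_on_imp_regular_near) blast
  obtain \<psi> where \<psi>: "regular_near U \<psi>" "\<And>x. x \<in> U \<Longrightarrow> \<psi> x = v x"
    using assms(2) by (rule regular_on_imp_regular_near) blast
  show ?thesis
    using regular_near_imp_regular_on[OF regular_near_mult[OF \<phi>(1) \<psi>(1)]]
    by (rule regular_on_cong) (simp add: \<phi>(2) \<psi>(2))
qed

declare topspace_zariski [simp]

lemma zariski_dense_open_self: "zariski_dense_open V V"
  using openin_topspace[of "subtopology zariski V"] closure_of_topspace[of "subtopology zariski V"]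
  unfolding zariski_dense_open_def by simp

lemma zariski_dense_open_Int:
  assumes "zariski_dense_open V U" "zariski_dense_open V W"
  shows "zariski_dense_open V (U \<inter> W)"
proof -
  let ?T = "subtopology zariski V"
  have U: "openin ?T U" "?T closure_of U = V" and W: "openin ?T W" "?T closure_of W = V"
    using assms unfolding zariski_dense_open_def by auto
  have "U \<subseteq> V"
    using openin_subset[OF U(1)] by simp
  then have "?T closure_of (U \<inter> W) = V"
    using closure_of_openin_Int_closure_of[OF U(1), of W] U(2) W(2) by (simp add: Int_absorb2)
  then show ?thesis
    using openin_Int[OF U(1) W(1)] unfolding zariski_dense_open_def by blast
qed

lemma generically_regular_polynomial:
  assumes "real_polynomial_function p" "\<And>x. x \<in> S \<Longrightarrow> u x = p x"
  shows "generically_regular V S u"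
proof -
  have "regular_on V p"
    by (intro regular_near_imp_regular_on regular_near_polynomial assms(1))
  moreover have "\<forall>x\<in>V \<inter> S. u x = p x"
    using assms(2) by simp
  ultimately show ?thesis
    unfolding generically_regular_def using zariski_dense_open_self[of V] by blast
qed

lemma generically_regular_add:
  assumes "generically_regular V S u" "generically_regular V S v"
    and w: "\<And>x. x \<in> S \<Longrightarrow> w x = u x + v x"
  shows "generically_regular V S w"
proof -
  obtain U a where U: "zariski_dense_open V U" "regular_on U a" "\<forall>x\<in>U \<inter> S. u x = a x"
    using assms(1) unfolding generically_regular_def by blast
  obtain W b where W: "zariski_dense_open V W" "regular_on W b" "\<forall>x\<in>W \<inter> S. v x = b x"
    using assms(2) unfolding generically_regular_def by blast
  have "regular_on (U \<inter> W) (\<lambda>x. a x + b x)"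
    by (intro regular_on_add regular_on_mono[OF U(2)] regular_on_mono[OF W(2)]) auto
  moreover have "\<forall>x\<in>(U \<inter> W) \<inter> S. w x = a x + b x"
    using U(3) W(3) w by simp
  ultimately show ?thesis
    unfolding generically_regular_def
    using zariski_dense_open_Int[OF U(1) W(1)] by (intro exI conjI) auto
qed

lemma generically_regular_mult:
  assumes "generically_regular V S u" "generically_regular V S v"
    and w: "\<And>x. x \<in> S \<Longrightarrow> w x = u x * v x"
  shows "generically_regular V S w"
proof -
  obtain U a where U: "zariski_dense_open V U" "regular_on U a" "\<forall>x\<in>U \<inter> S. u x = a x"
    using assms(1) unfolding generically_regular_def by blast
  obtain W b where W: "zariski_dense_open V W" "regular_on W b" "\<forall>x\<in>W \<inter> S. v x = b x"
    using assms(2) unfolding generically_regular_def by blast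
  have "regular_on (U \<inter> W) (\<lambda>x. a x * b x)"
    by (intro regular_on_mult regular_on_mono[OF U(2)] regular_on_mono[OF W(2)]) auto
  moreover have "\<forall>x\<in>(U \<inter> W) \<inter> S. w x = a x * b x"
    using U(3) W(3) w by simp
  ultimately show ?thesis
    unfolding generically_regular_def
    using zariski_dense_open_Int[OF U(1) W(1)] by (intro exI conjI) auto
qed

lemma carrier_K0_Cent:
  "carrier (K0_Cent X) =
     {u \<in> extensional (Cent X). continuous_on (Cent X) u \<and> generically_regular X (Cent X) u}"
  by (simp only: K0_Cent_def fun_ring_def generically_regular_def partial_object.select_convs)

lemma carrier_R0_Cent:
  "carrier (R0_Cent X) =
     {u \<in> carrier (K0_Cent X). \<forall>V. central_in X V \<longrightarrow> generically_regular V (Cent X) u}"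
  by (simp only: R0_Cent_def fun_ring_def generically_regular_def partial_object.select_convs)

lemma zariski_closure_eq:
  assumes "S \<subseteq> V" "real_algebraic_set V"
  shows "zariski closure_of S = subtopology zariski V closure_of S"
proof -
  have "zariski closure_of S \<subseteq> V"
    using assms by (intro closure_of_minimal) (simp_all add: closedin_zariski)
  then show ?thesis
    using assms(1) by (simp add: closure_of_subtopology Int_absorb1)
qed

section \<open>Pullback of continuous rational functions\<close>

context biregular_pair
begin

lemma zariski_continuous: "continuous_map (subtopology zariski X) (subtopology zariski Y) f"
  unfolding continuous_map_closedin
proof (intro conjI allI impI)
  show "f \<in> topspace (subtopology zariski X) \<rightarrow> topspace (subtopology zariski Y)"
    using f_in by auto
  fix C assume "closedin (subtopology zariski Y) C"
  then obtain T where T: "real_algebraic_set T" "C = T \<inter> Y"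
    unfolding closedin_subtopology closedin_zariski by blast
  have "{x \<in> topspace (subtopology zariski X). f x \<in> C} = {x \<in> X. f x \<in> T} \<inter> X"
    using T(2) f_in by auto
  then show "closedin (subtopology zariski X) {x \<in> topspace (subtopology zariski X). f x \<in> C}"
    using algebraic_preimage[OF T(1)] unfolding closedin_subtopology closedin_zariski by blast
qed

lemma zariski_homeomorphic: "homeomorphic_map (subtopology zariski X) (subtopology zariski Y) f"
  using zariski_continuous biregular_pair.zariski_continuous[OF swap] gf fg
  by (intro homeomorphic_maps_imp_map[of _ _ f g]) (simp add: homeomorphic_maps_def)

lemma zariski_dense_open_preimage:
  assumes "zariski_dense_open Y W"
  shows "zariski_dense_open X {x \<in> X. f x \<in> W}"
proof -
  have W: "openin (subtopology zariski Y) W" "subtopology zariski Y closure_of W = Y"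
    using assms unfolding zariski_dense_open_def by auto
  have sub: "W \<subseteq> topspace (subtopology zariski Y)"
    using W(1) by (rule openin_subset)
  note hom = biregular_pair.zariski_homeomorphic[OF swap]
  have "{x \<in> X. f x \<in> W} = g ` W"
    using biregular_pair.image_eq_preimage[OF swap, of W] sub by simp
  moreover have "openin (subtopology zariski X) (g ` W)"
    using homeomorphic_map_openness[OF hom sub] W(1) by simp
  moreover have "subtopology zariski X closure_of (g ` W) = X"
    using homeomorphic_map_closure_of[OF hom sub] W(2) biregular_pair.image_eq[OF swap] by simp
  ultimately show ?thesis
    unfolding zariski_dense_open_def by simp
qed

lemma generically_regular_pullback:
  assumes "generically_regular Y T u" "f ` S \<subseteq> T" and v: "\<And>x. x \<in> S \<Longrightarrow> v x = u (f x)"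
  shows "generically_regular X S v"
proof -
  obtain W h where W: "zariski_dense_open Y W" "regular_on W h" "\<forall>y\<in>W \<inter> T. u y = h y"
    using assms(1) unfolding generically_regular_def by blast
  let ?U = "{x \<in> X. f x \<in> W}"
  have "regular_on ?U (\<lambda>x. h (f x))"
    by (rule regular_on_compose[OF regular_near_mono[OF f_regular] _ W(2)]) auto
  moreover have "\<forall>x\<in>?U \<inter> S. v x = h (f x)"
    using W(3) assms(2) v by auto
  ultimately show ?thesis
    unfolding generically_regular_def
    using zariski_dense_open_preimage[OF W(1)] by (intro exI conjI) auto
qed

text \<open>
  As \<open>V\<close> and \<open>f ` V\<close> are Zariski closed, the two closures can be taken inside them, where \<open>f\<close> is a
  homeomorphism.
\<close>

lemma central_in_image:
  assumes "central_in X V"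
  shows "central_in Y (f ` V)"
proof -
  have V: "irreducible_algebraic_set V" "V \<subseteq> X" "zariski closure_of (V \<inter> Cent X) = V"
    using assms unfolding central_in_def by auto
  have alg: "real_algebraic_set V"
    using V(1) unfolding irreducible_algebraic_set_def by auto
  interpret V: biregular_pair V "f ` V" f g
    using alg V(2) by (rule restrict_pair)
  have "f ` V \<inter> Cent Y = f ` (V \<inter> Cent X)"
    using inj_on_image_Int[OF inj_on_f V(2) Cent_subset] Cent_image by simp
  moreover have "zariski closure_of (f ` (V \<inter> Cent X)) = f ` V"
  proof -
    have "zariski closure_of (f ` (V \<inter> Cent X)) =
        subtopology zariski (f ` V) closure_of (f ` (V \<inter> Cent X))"
      by (rule zariski_closure_eq) (auto intro: V.algebraic_Y)
    also have "\<dots> = f ` (subtopology zariski V closure_of (V \<inter> Cent X))"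
      by (rule homeomorphic_map_closure_of[OF V.zariski_homeomorphic]) simp
    also have "subtopology zariski V closure_of (V \<inter> Cent X) = V"
      using zariski_closure_eq[of "V \<inter> Cent X" V] alg V(3) by simp
    finally show ?thesis .
  qed
  moreover have "f ` V \<subseteq> Y"
    using V(2) f_in by blast
  ultimately show ?thesis
    using irreducible_image[OF V(1,2)] unfolding central_in_def by simp
qed

lemma K0_Cent_pullback:
  assumes "u \<in> carrier (K0_Cent Y)"
  shows "(\<lambda>x\<in>Cent X. u (f x)) \<in> carrier (K0_Cent X)"
proof -
  have u: "continuous_on (Cent Y) u" "generically_regular Y (Cent Y) u"
    using assms unfolding carrier_K0_Cent by auto
  have "continuous_on (Cent X) f"
    using f_isCont Cent_subset by (intro continuous_at_imp_continuous_on) auto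
  then have "continuous_on (Cent X) (\<lambda>x. u (f x))"
    using continuous_on_compose2[OF u(1) _ Cent_image_subset] by blast
  then have "continuous_on (Cent X) (\<lambda>x\<in>Cent X. u (f x))"
    by (rule continuous_on_eq) simp
  moreover have "generically_regular X (Cent X) (\<lambda>x\<in>Cent X. u (f x))"
    by (rule generically_regular_pullback[OF u(2) Cent_image_subset]) simp
  ultimately show ?thesis
    unfolding carrier_K0_Cent by simp
qed

text \<open>
  For a central subset \<open>V\<close> of \<open>X\<close>, the restriction of \<open>f\<close> to a map \<open>V \<rightarrow> f ` V\<close> reduces the condition
  on \<open>V\<close> to that on the central subset \<open>f ` V\<close> of \<open>Y\<close>.
\<close>

lemma R0_Cent_pullback:
  assumes "u \<in> carrier (R0_Cent Y)"
  shows "(\<lambda>x\<in>Cent X. u (f x)) \<in> carrier (R0_Cent X)"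
proof -
  have u: "u \<in> carrier (K0_Cent Y)"
    and gen: "\<And>V. central_in Y V \<Longrightarrow> generically_regular V (Cent Y) u"
    using assms unfolding carrier_R0_Cent by auto
  have "generically_regular V (Cent X) (\<lambda>x\<in>Cent X. u (f x))" if V: "central_in X V" for V
  proof -
    have "real_algebraic_set V" "V \<subseteq> X"
      using V unfolding central_in_def irreducible_algebraic_set_def by auto
    then interpret V: biregular_pair V "f ` V" f g
      by (rule restrict_pair)
    show ?thesis
      by (rule V.generically_regular_pullback[OF gen[OF central_in_image[OF V]] Cent_image_subset])
        simp
  qed
  then show ?thesis
    using K0_Cent_pullback[OF u] unfolding carrier_R0_Cent by simp
qed

end

section \<open>Rings of functions and integral closures\<close>

text \<open>
  The closure properties ensure that the finite sums in the ring \<open>fun_ring S K\<close>, which are meaningful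
  only for summands in its carrier, are computed pointwise.
\<close>

locale function_algebra =
  fixes S :: "(real ^ 'n) set" and K :: "(real ^ 'n \<Rightarrow> real) set"
  assumes extensional: "u \<in> K \<Longrightarrow> u \<in> extensional S"
    and polynomial: "real_polynomial_function p \<Longrightarrow> restrict p S \<in> K"
    and add_closed: "u \<in> K \<Longrightarrow> v \<in> K \<Longrightarrow> (\<lambda>x\<in>S. u x + v x) \<in> K"
    and mult_closed: "u \<in> K \<Longrightarrow> v \<in> K \<Longrightarrow> (\<lambda>x\<in>S. u x * v x) \<in> K"
begin

lemma const_closed: "(\<lambda>x\<in>S. c) \<in> K"
  using polynomial[OF real_polynomial_function.intros(2)] .

lemma abelian_monoid_fun_ring: "abelian_monoid (fun_ring S K)"
proof (rule abelian_monoidI)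
  fix u v assume "u \<in> carrier (fun_ring S K)" "v \<in> carrier (fun_ring S K)"
  then show "u \<oplus>\<^bsub>fun_ring S K\<^esub> v \<in> carrier (fun_ring S K)"
    by (simp add: fun_ring_def add_closed)
next
  show "\<zero>\<^bsub>fun_ring S K\<^esub> \<in> carrier (fun_ring S K)"
    using const_closed[of 0] by (simp add: fun_ring_def)
next
  fix u assume "u \<in> carrier (fun_ring S K)"
  then have "u \<in> extensional S"
    by (simp add: fun_ring_def extensional)
  then show "\<zero>\<^bsub>fun_ring S K\<^esub> \<oplus>\<^bsub>fun_ring S K\<^esub> u = u"
    by (intro extensionalityI[of _ S]) (simp_all add: fun_ring_def)
next
  fix u v w
  show "(u \<oplus>\<^bsub>fun_ring S K\<^esub> v) \<oplus>\<^bsub>fun_ring S K\<^esub> w =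
      u \<oplus>\<^bsub>fun_ring S K\<^esub> (v \<oplus>\<^bsub>fun_ring S K\<^esub> w)"
    by (rule ext) (simp add: fun_ring_def)
  show "u \<oplus>\<^bsub>fun_ring S K\<^esub> v = v \<oplus>\<^bsub>fun_ring S K\<^esub> u"
    by (rule ext) (simp add: fun_ring_def add.commute)
qed

lemma pow_fun_ring: "u [^]\<^bsub>fun_ring S K\<^esub> (n :: nat) = (\<lambda>x\<in>S. u x ^ n)"
  by (induction n) (simp_all add: fun_ring_def fun_eq_iff)

lemma pow_closed:
  assumes "u \<in> K"
  shows "(\<lambda>x\<in>S. u x ^ n) \<in> K"
proof (induction n)
  case 0
  show ?case
    unfolding power_0 by (rule const_closed)
next
  case (Suc n)
  have "(\<lambda>x\<in>S. u x ^ Suc n) = (\<lambda>x\<in>S. u x * (\<lambda>x\<in>S. u x ^ n) x)"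
    by (auto simp: fun_eq_iff)
  then show ?case
    using mult_closed[OF assms Suc] by metis
qed

lemma finsum_fun_ring:
  assumes "finite I" "\<And>i. i \<in> I \<Longrightarrow> c i \<in> K"
  shows "(\<Oplus>\<^bsub>fun_ring S K\<^esub>i\<in>I. c i) = (\<lambda>x\<in>S. \<Sum>i\<in>I. c i x)"
proof -
  interpret R: abelian_monoid "fun_ring S K"
    by (rule abelian_monoid_fun_ring)
  show ?thesis
    using assms
  proof (induction I)
    case empty
    show ?case
      unfolding R.finsum_empty by (simp add: fun_ring_def)
  next
    case (insert i I)
    then have "(\<Oplus>\<^bsub>fun_ring S K\<^esub>i\<in>insert i I. c i) = c i \<oplus>\<^bsub>fun_ring S K\<^esub> (\<lambda>x\<in>S. \<Sum>i\<in>I. c i x)"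
      by (subst R.finsum_insert) (auto simp: fun_ring_def)
    then show ?case
      using insert(1,2) by (auto simp: fun_ring_def fun_eq_iff)
  qed
qed

end

definition integral_over_polynomials :: "(real ^ 'n) set \<Rightarrow> (real ^ 'n \<Rightarrow> real) \<Rightarrow> bool" where
  "integral_over_polynomials S u \<longleftrightarrow>
     (\<exists>n p. (\<forall>i<n. real_polynomial_function (p i)) \<and>
        (\<forall>x\<in>S. u x ^ n + (\<Sum>i<n. p i x * u x ^ i) = 0))"

lemma (in function_algebra) carrier_integral_closure:
  "carrier (integral_closure (polynomials_on S) (fun_ring S K)) =
     {u \<in> K. integral_over_polynomials S u}"
proof -
  have eq: "u [^]\<^bsub>fun_ring S K\<^esub> n \<oplus>\<^bsub>fun_ring S K\<^esub>
        (\<Oplus>\<^bsub>fun_ring S K\<^esub>i\<in>{..<n}. c i \<otimes>\<^bsub>fun_ring S K\<^esub> u [^]\<^bsub>fun_ring S K\<^esub> i) = \<zero>\<^bsub>fun_ring S K\<^esub>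
      \<longleftrightarrow> (\<forall>x\<in>S. u x ^ n + (\<Sum>i<n. c i x * u x ^ i) = 0)"
    if "u \<in> K" and c: "c \<in> {..<n} \<rightarrow> polynomials_on S" for u and n :: nat and c
  proof -
    have term_eq: "c i \<otimes>\<^bsub>fun_ring S K\<^esub> u [^]\<^bsub>fun_ring S K\<^esub> i = (\<lambda>x\<in>S. c i x * u x ^ i)" for i :: nat
      unfolding pow_fun_ring by (rule ext) (simp add: fun_ring_def)
    have term_in: "(\<lambda>x\<in>S. c i x * u x ^ i) \<in> K" if "i < n" for i
    proof -
      have "c i \<in> polynomials_on S"
        using c that by (rule funcset_mem[OF _ lessThan_iff[THEN iffD2]])
      then have "c i \<in> K"
        using polynomial unfolding polynomials_on_def by auto
      then have "(\<lambda>x\<in>S. c i x * (\<lambda>x\<in>S. u x ^ i) x) \<in> K"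
        using mult_closed pow_closed[OF \<open>u \<in> K\<close>] by blast
      also have "(\<lambda>x\<in>S. c i x * (\<lambda>x\<in>S. u x ^ i) x) = (\<lambda>x\<in>S. c i x * u x ^ i)"
        by (simp add: fun_eq_iff)
      finally show ?thesis .
    qed
    have "(\<Oplus>\<^bsub>fun_ring S K\<^esub>i\<in>{..<n}. c i \<otimes>\<^bsub>fun_ring S K\<^esub> u [^]\<^bsub>fun_ring S K\<^esub> i) =
        (\<lambda>x\<in>S. \<Sum>i<n. (\<lambda>x\<in>S. c i x * u x ^ i) x)"
      unfolding term_eq by (rule finsum_fun_ring) (use term_in in auto)
    then show ?thesis
      unfolding pow_fun_ring by (auto simp: fun_ring_def fun_eq_iff)
  qed
  show ?thesis
  proof (intro equalityI subsetI)
    fix u assume "u \<in> carrier (integral_closure (polynomials_on S) (fun_ring S K))"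
    then obtain n c where u: "u \<in> K" and c: "c \<in> {..<n::nat} \<rightarrow> polynomials_on S"
      and "u [^]\<^bsub>fun_ring S K\<^esub> n \<oplus>\<^bsub>fun_ring S K\<^esub>
        (\<Oplus>\<^bsub>fun_ring S K\<^esub>i\<in>{..<n}. c i \<otimes>\<^bsub>fun_ring S K\<^esub> u [^]\<^bsub>fun_ring S K\<^esub> i) = \<zero>\<^bsub>fun_ring S K\<^esub>"
      unfolding integral_closure_def by (auto simp: fun_ring_def)
    then have int: "\<forall>x\<in>S. u x ^ n + (\<Sum>i<n. c i x * u x ^ i) = 0"
      using eq by blast
    have "\<forall>i\<in>{..<n}. \<exists>p. real_polynomial_function p \<and> c i = restrict p S"
      using c unfolding polynomials_on_def by blast
    from bchoice[OF this] obtain p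
      where p: "\<forall>i\<in>{..<n}. real_polynomial_function (p i) \<and> c i = restrict (p i) S" ..
    have "\<forall>x\<in>S. u x ^ n + (\<Sum>i<n. p i x * u x ^ i) = 0"
      using int p by simp
    then show "u \<in> {u \<in> K. integral_over_polynomials S u}"
      using u p unfolding integral_over_polynomials_def by auto
  next
    fix u assume "u \<in> {u \<in> K. integral_over_polynomials S u}"
    then obtain n p where u: "u \<in> K" and p: "\<forall>i<n. real_polynomial_function (p i)"
      and int: "\<forall>x\<in>S. u x ^ n + (\<Sum>i<n. p i x * u x ^ i) = 0"
      unfolding integral_over_polynomials_def by blast
    define c where "c i = restrict (p i) S" for i
    have c: "c \<in> {..<n} \<rightarrow> polynomials_on S"
      using p unfolding c_def polynomials_on_def by blast
    have "\<forall>x\<in>S. u x ^ n + (\<Sum>i<n. c i x * u x ^ i) = 0"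
      using int by (simp add: c_def)
    then have "u [^]\<^bsub>fun_ring S K\<^esub> n \<oplus>\<^bsub>fun_ring S K\<^esub>
        (\<Oplus>\<^bsub>fun_ring S K\<^esub>i\<in>{..<n}. c i \<otimes>\<^bsub>fun_ring S K\<^esub> u [^]\<^bsub>fun_ring S K\<^esub> i) = \<zero>\<^bsub>fun_ring S K\<^esub>"
      using eq[OF u c] by blast
    then show "u \<in> carrier (integral_closure (polynomials_on S) (fun_ring S K))"
      using u c unfolding integral_closure_def by (auto simp: fun_ring_def)
  qed
qed

lemma integral_over_polynomials_polynomial:
  assumes "real_polynomial_function p" "\<And>x. x \<in> S \<Longrightarrow> u x = p x"
  shows "integral_over_polynomials S u"
  unfolding integral_over_polynomials_def
  by (rule exI[of _ 1], rule exI[of _ "\<lambda>i x. - p x"]) (use assms in auto)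

lemma common_denominator:
  fixes n :: nat
  assumes "\<And>i. i < n \<Longrightarrow> regular_near X (\<phi> i)"
  shows "\<exists>e a. real_polynomial_function e \<and> (\<forall>x\<in>X. e x \<noteq> 0) \<and>
     (\<forall>i<n. real_polynomial_function (a i) \<and> (\<forall>x\<in>X. e x * \<phi> i x = a i x))"
  using assms
proof (induction n)
  case 0
  show ?case
    by (rule exI[of _ "\<lambda>x. 1"]) (auto intro: real_polynomial_function.intros(2))
next
  case (Suc n)
  then obtain e a where e: "real_polynomial_function e" "\<forall>x\<in>X. e x \<noteq> 0"
    and a: "\<forall>i<n. real_polynomial_function (a i) \<and> (\<forall>x\<in>X. e x * \<phi> i x = a i x)"
    by (metis less_Suc_eq)
  obtain b d where bd: "real_polynomial_function b" "real_polynomial_function d"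
    "\<And>x. x \<in> X \<Longrightarrow> d x \<noteq> 0" "\<And>x. d x \<noteq> 0 \<Longrightarrow> \<phi> n x = b x / d x"
    using Suc.prems[of n] by (auto elim: regular_nearE)
  define a' where "a' i = (if i = n then (\<lambda>x. e x * b x) else (\<lambda>x. d x * a i x))" for i
  have "real_polynomial_function (a' i) \<and> (\<forall>x\<in>X. (e x * d x) * \<phi> i x = a' i x)" if "i < Suc n" for i
  proof (cases "i = n")
    case True
    then show ?thesis
      using e bd by (auto simp: a'_def)
  next
    case False
    then have "i < n"
      using that by simp
    then have "real_polynomial_function (a i)" "\<forall>x\<in>X. e x * \<phi> i x = a i x"
      using a by auto
    then show ?thesis
      using bd(2) False by (auto simp: a'_def mult.assoc mult.left_commute)
  qed
  moreover have "real_polynomial_function (\<lambda>x. e x * d x)" "\<forall>x\<in>X. e x * d x \<noteq> 0"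
    using e bd(2,3) by auto
  ultimately show ?case
    by blast
qed

text \<open>
  If \<open>u\<close> satisfies a monic equation of degree \<open>n\<close> with coefficients \<open>p i\<close> and \<open>e\<close> is a common
  denominator of all \<open>p i \<circ> f\<close>, then \<open>e \<cdot> (u \<circ> f)\<close> satisfies the monic equation with coefficients
  \<open>e\<^sup>n\<^sup>-\<^sup>i \<cdot> (p i \<circ> f)\<close>, which are polynomials.
\<close>

lemma (in biregular_pair) integral_pullback:
  assumes "integral_over_polynomials T u" "f ` S \<subseteq> T" "S \<subseteq> X"
  obtains e where "real_polynomial_function e" "\<And>x. x \<in> X \<Longrightarrow> e x \<noteq> 0"
    "integral_over_polynomials S (\<lambda>x\<in>S. e x * u (f x))"
proof -
  obtain n p where p: "\<And>i. i < n \<Longrightarrow> real_polynomial_function (p i)"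
    and int: "\<forall>y\<in>T. u y ^ n + (\<Sum>i<n. p i y * u y ^ i) = 0"
    using assms(1) unfolding integral_over_polynomials_def by blast
  have "regular_near X (\<lambda>x. p i (f x))" if "i < n" for i
    using f_regular p[OF that] by (rule regular_near_polynomial_compose)
  then obtain e a where e: "real_polynomial_function e" "\<forall>x\<in>X. e x \<noteq> 0"
    and a: "\<forall>i<n. real_polynomial_function (a i) \<and> (\<forall>x\<in>X. e x * p i (f x) = a i x)"
    using common_denominator[of n X "\<lambda>i x. p i (f x)"] by blast
  \<comment> \<open>One of the \<open>n - i\<close> factors \<open>e\<close> is already contained in \<open>a i\<close>.\<close>
  define b where "b i = (\<lambda>x. e x ^ (n - Suc i) * a i x)" for i
  have "(e x * u (f x)) ^ n + (\<Sum>i<n. b i x * (e x * u (f x)) ^ i) = 0" if x: "x \<in> S" for x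
  proof -
    have "b i x * (e x * u (f x)) ^ i = e x ^ n * (p i (f x) * u (f x) ^ i)" if i: "i < n" for i
    proof -
      have "a i x = e x * p i (f x)"
        using a i x assms(3) by auto
      moreover have "e x ^ (n - Suc i) * e x * e x ^ i = e x ^ n"
      proof -
        have "n = (n - Suc i) + 1 + i"
          using i by simp
        then show ?thesis
          by (metis power_add power_one_right)
      qed
      ultimately have "b i x * (e x * u (f x)) ^ i =
          (e x ^ (n - Suc i) * e x * e x ^ i) * (p i (f x) * u (f x) ^ i)"
        by (simp add: b_def power_mult_distrib)
      then show ?thesis
        unfolding \<open>e x ^ (n - Suc i) * e x * e x ^ i = e x ^ n\<close> .
    qed
    then have "(\<Sum>i<n. b i x * (e x * u (f x)) ^ i) =
        e x ^ n * (\<Sum>i<n. p i (f x) * u (f x) ^ i)"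
      unfolding sum_distrib_left by (intro sum.cong) auto
    then have "(e x * u (f x)) ^ n + (\<Sum>i<n. b i x * (e x * u (f x)) ^ i) =
        e x ^ n * (u (f x) ^ n + (\<Sum>i<n. p i (f x) * u (f x) ^ i))"
      by (simp only: power_mult_distrib distrib_left)
    also have "u (f x) ^ n + (\<Sum>i<n. p i (f x) * u (f x) ^ i) = 0"
      using int x assms(2) by blast
    finally show ?thesis
      by simp
  qed
  moreover have "\<forall>i<n. real_polynomial_function (b i)"
    using a e(1) unfolding b_def by auto
  ultimately have "integral_over_polynomials S (\<lambda>x\<in>S. e x * u (f x))"
    unfolding integral_over_polynomials_def by (intro exI[of _ n] exI[of _ b]) simp
  then show ?thesis
    using that e by blast
qed

lemma function_algebra_K0_Cent: "function_algebra (Cent X) (carrier (K0_Cent X))"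
proof
  fix p :: "real ^ 'a \<Rightarrow> real" assume p: "real_polynomial_function p"
  have "continuous_on (Cent X) p"
    using p by (intro continuous_at_imp_continuous_on) (auto intro: continuous_real_polymonial_function)
  then have "continuous_on (Cent X) (restrict p (Cent X))"
    by (rule continuous_on_eq) simp
  then show "restrict p (Cent X) \<in> carrier (K0_Cent X)"
    using generically_regular_polynomial[OF p, of "Cent X" "restrict p (Cent X)" X]
    unfolding carrier_K0_Cent by simp
next
  fix u v assume u: "u \<in> carrier (K0_Cent X)" and v: "v \<in> carrier (K0_Cent X)"
  have uv: "continuous_on (Cent X) u" "continuous_on (Cent X) v"
    "generically_regular X (Cent X) u" "generically_regular X (Cent X) v"
    using u v unfolding carrier_K0_Cent by auto
  have "continuous_on (Cent X) (\<lambda>x\<in>Cent X. u x + v x)"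
    by (rule continuous_on_eq[OF continuous_on_add[OF uv(1,2)]]) simp
  moreover have "generically_regular X (Cent X) (\<lambda>x\<in>Cent X. u x + v x)"
    by (rule generically_regular_add[OF uv(3,4)]) simp
  ultimately show "(\<lambda>x\<in>Cent X. u x + v x) \<in> carrier (K0_Cent X)"
    unfolding carrier_K0_Cent by simp
  have "continuous_on (Cent X) (\<lambda>x\<in>Cent X. u x * v x)"
    by (rule continuous_on_eq[OF continuous_on_mult[OF uv(1,2)]]) simp
  moreover have "generically_regular X (Cent X) (\<lambda>x\<in>Cent X. u x * v x)"
    by (rule generically_regular_mult[OF uv(3,4)]) simp
  ultimately show "(\<lambda>x\<in>Cent X. u x * v x) \<in> carrier (K0_Cent X)"
    unfolding carrier_K0_Cent by simp
qed (simp add: carrier_K0_Cent)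

lemma function_algebra_R0_Cent: "function_algebra (Cent X) (carrier (R0_Cent X))"
proof -
  interpret K0: function_algebra "Cent X" "carrier (K0_Cent X)"
    by (rule function_algebra_K0_Cent)
  show ?thesis
  proof
    fix u assume "u \<in> carrier (R0_Cent X)"
    then show "u \<in> extensional (Cent X)"
      using K0.extensional unfolding carrier_R0_Cent by auto
  next
    fix p :: "real ^ 'a \<Rightarrow> real" assume p: "real_polynomial_function p"
    then show "restrict p (Cent X) \<in> carrier (R0_Cent X)"
      using K0.polynomial generically_regular_polynomial[OF p, of "Cent X" "restrict p (Cent X)"]
      unfolding carrier_R0_Cent by simp
  next
    fix u v assume u: "u \<in> carrier (R0_Cent X)" and v: "v \<in> carrier (R0_Cent X)"
    have K: "u \<in> carrier (K0_Cent X)" "v \<in> carrier (K0_Cent X)"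
      and gen: "\<And>V. central_in X V \<Longrightarrow> generically_regular V (Cent X) u"
        "\<And>V. central_in X V \<Longrightarrow> generically_regular V (Cent X) v"
      using u v unfolding carrier_R0_Cent by auto
    have "generically_regular V (Cent X) (\<lambda>x\<in>Cent X. u x + v x)" if "central_in X V" for V
      by (rule generically_regular_add[OF gen(1)[OF that] gen(2)[OF that]]) simp
    then show "(\<lambda>x\<in>Cent X. u x + v x) \<in> carrier (R0_Cent X)"
      using K0.add_closed[OF K] unfolding carrier_R0_Cent by simp
    have "generically_regular V (Cent X) (\<lambda>x\<in>Cent X. u x * v x)" if "central_in X V" for V
      by (rule generically_regular_mult[OF gen(1)[OF that] gen(2)[OF that]]) simp
    then show "(\<lambda>x\<in>Cent X. u x * v x) \<in> carrier (R0_Cent X)"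
      using K0.mult_closed[OF K] unfolding carrier_R0_Cent by simp
  qed
qed

section \<open>Real characters of rings of functions\<close>

definition character ::
  "(real ^ 'n) set \<Rightarrow> (real ^ 'n \<Rightarrow> real) set \<Rightarrow> ((real ^ 'n \<Rightarrow> real) \<Rightarrow> real) \<Rightarrow> bool" where
  "character S A \<xi> \<longleftrightarrow>
     (\<forall>u\<in>A. \<forall>v\<in>A. \<xi> (\<lambda>x\<in>S. u x + v x) = \<xi> u + \<xi> v) \<and>
     (\<forall>u\<in>A. \<forall>v\<in>A. \<xi> (\<lambda>x\<in>S. u x * v x) = \<xi> u * \<xi> v) \<and>
     (\<forall>c. \<xi> (\<lambda>x\<in>S. c) = c)"

lemma character_add: "character S A \<xi> \<Longrightarrow> u \<in> A \<Longrightarrow> v \<in> A \<Longrightarrow> \<xi> (\<lambda>x\<in>S. u x + v x) = \<xi> u + \<xi> v"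
  and character_mult: "character S A \<xi> \<Longrightarrow> u \<in> A \<Longrightarrow> v \<in> A \<Longrightarrow> \<xi> (\<lambda>x\<in>S. u x * v x) = \<xi> u * \<xi> v"
  and character_const: "character S A \<xi> \<Longrightarrow> \<xi> (\<lambda>x\<in>S. c) = c"
  unfolding character_def by blast+

lemma polynomials_onI: "real_polynomial_function p \<Longrightarrow> restrict p S \<in> polynomials_on S"
  unfolding polynomials_on_def by blast

lemma polynomials_onE:
  assumes "u \<in> polynomials_on S"
  obtains p where "real_polynomial_function p" "u = restrict p S"
  using assms unfolding polynomials_on_def by blast

lemma polynomials_on_closed:
  assumes "p \<in> polynomials_on Z" "q \<in> polynomials_on Z"
  shows "(\<lambda>x\<in>Z. p x + q x) \<in> polynomials_on Z" "(\<lambda>x\<in>Z. p x * q x) \<in> polynomials_on Z"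
proof -
  obtain p' where p': "real_polynomial_function p'" "p = restrict p' Z"
    using assms(1) by (rule polynomials_onE)
  obtain q' where q': "real_polynomial_function q'" "q = restrict q' Z"
    using assms(2) by (rule polynomials_onE)
  have "(\<lambda>x\<in>Z. p x + q x) = restrict (\<lambda>x. p' x + q' x) Z"
    "(\<lambda>x\<in>Z. p x * q x) = restrict (\<lambda>x. p' x * q' x) Z"
    by (rule restrict_ext, simp add: p' q')+
  then show "(\<lambda>x\<in>Z. p x + q x) \<in> polynomials_on Z" "(\<lambda>x\<in>Z. p x * q x) \<in> polynomials_on Z"
    using polynomials_onI real_polynomial_function.intros(3,4)[OF p'(1) q'(1)] by metis+
qed

text \<open>
  Polynomials are generated by the coordinates, so a character acts on them as evaluation at the point
  whose coordinates are its values at the coordinate functions.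
\<close>

lemma character_polynomial:
  fixes S :: "(real ^ 'n) set"
  assumes ch: "character S A \<xi>" and sub: "polynomials_on S \<subseteq> A" and p: "real_polynomial_function p"
  shows "\<xi> (restrict p S) = p (\<chi> j. \<xi> (\<lambda>x\<in>S. x $ j))"
proof -
  define R where "R p = \<xi> (restrict p S)" for p
  have R_add: "R (\<lambda>x. p x + q x) = R p + R q"
    if "real_polynomial_function p" "real_polynomial_function q" for p q
  proof -
    have "(\<lambda>x\<in>S. p x + q x) = (\<lambda>x\<in>S. restrict p S x + restrict q S x)"
      by (rule restrict_ext) simp
    then show ?thesis
      unfolding R_def using character_add[OF ch] that polynomials_onI sub by (metis subsetD)
  qed
  have R_mult: "R (\<lambda>x. p x * q x) = R p * R q"
    if "real_polynomial_function p" "real_polynomial_function q" for p q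
  proof -
    have "(\<lambda>x\<in>S. p x * q x) = (\<lambda>x\<in>S. restrict p S x * restrict q S x)"
      by (rule restrict_ext) simp
    then show ?thesis
      unfolding R_def using character_mult[OF ch] that polynomials_onI sub by (metis subsetD)
  qed
  have R_const: "R (\<lambda>x. c) = c" for c
    unfolding R_def by (rule character_const[OF ch])
  have coord: "real_polynomial_function (\<lambda>x. x $ j)" for j :: 'n
    by (intro real_polynomial_function.intros(1) bounded_linear_vec_nth)
  have term_poly: "real_polynomial_function (\<lambda>x. x $ j * c)" for j :: 'n and c
    by (intro real_polynomial_function.intros(4,2) coord)
  have R_sum: "R (\<lambda>x. \<Sum>j\<in>I. x $ j * c j) = (\<Sum>j\<in>I. R (\<lambda>x. x $ j) * c j)"
    if "finite I" for I and c :: "'n \<Rightarrow> real"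
    using that
  proof (induction I)
    case (insert j I)
    have "real_polynomial_function (\<lambda>x. \<Sum>j\<in>I. x $ j * c j)"
      using insert(1) term_poly by (rule real_polynomial_function_sum)
    then have "R (\<lambda>x. x $ j * c j + (\<Sum>j\<in>I. x $ j * c j)) =
        R (\<lambda>x. x $ j * c j) + R (\<lambda>x. \<Sum>j\<in>I. x $ j * c j)"
      using R_add term_poly by blast
    moreover have "R (\<lambda>x. x $ j * c j) = R (\<lambda>x. x $ j) * c j"
      using R_mult[OF coord real_polynomial_function.intros(2)] R_const by simp
    ultimately show ?case
      using insert by simp
  qed (simp add: R_const)
  have "R p = p (\<chi> j. R (\<lambda>x. x $ j))"
    using p
  proof induction
    case (linear p)
    note p_eq = bounded_linear_coordinates[OF linear]
    have "R p = R (\<lambda>x. \<Sum>j\<in>UNIV. x $ j * p (axis j 1))"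
      by (rule arg_cong[of _ _ R]) (rule ext, rule p_eq)
    also have "\<dots> = (\<Sum>j\<in>UNIV. R (\<lambda>x. x $ j) * p (axis j 1))"
      by (rule R_sum) simp
    also have "\<dots> = p (\<chi> j. R (\<lambda>x. x $ j))"
      by (subst p_eq[of "\<chi> j. R (\<lambda>x. x $ j)"]) simp
    finally show ?case .
  qed (simp_all add: R_const R_add R_mult)
  then show ?thesis
    unfolding R_def .
qed

text \<open>
  A polynomial that vanishes on \<open>X\<close> restricts to the zero function on \<open>S\<close>, hence vanishes at the point.
  The point itself may lie outside \<open>S\<close>.
\<close>

lemma character_point_in:
  assumes ch: "character S A \<xi>" and sub: "polynomials_on S \<subseteq> A"
    and X: "real_algebraic_set X" "S \<subseteq> X"
  shows "(\<chi> j. \<xi> (\<lambda>x\<in>S. x $ j)) \<in> X"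
proof -
  obtain F where F: "\<forall>p\<in>F. real_polynomial_function p" "X = {x. \<forall>p\<in>F. p x = 0}"
    using X(1) unfolding real_algebraic_set_def by blast
  have "p (\<chi> j. \<xi> (\<lambda>x\<in>S. x $ j)) = 0" if "p \<in> F" for p
  proof -
    have "restrict p S = (\<lambda>x\<in>S. 0)"
      by (rule restrict_ext) (use that F(2) X(2) in auto)
    then have "\<xi> (restrict p S) = 0"
      using character_const[OF ch, of 0] by metis
    then show ?thesis
      using character_polynomial[OF ch sub] F(1) that by auto
  qed
  then show ?thesis
    unfolding F(2) by blast
qed

section \<open>Localization at the polynomials without zeros\<close>

definition denominator :: "(real ^ 'n) set \<Rightarrow> (real ^ 'n \<Rightarrow> real) \<Rightarrow> bool" where
  "denominator X s \<longleftrightarrow> real_polynomial_function s \<and> (\<forall>x\<in>X. s x \<noteq> 0)"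

lemma denominator_mult: "denominator X s \<Longrightarrow> denominator X t \<Longrightarrow> denominator X (\<lambda>x. s x * t x)"
  unfolding denominator_def by auto

lemma denominator_one: "denominator X (\<lambda>x. 1)"
  unfolding denominator_def by auto

text \<open>
  The localization of \<open>A\<close> at the denominators, realised by functions on \<open>S\<close>; the denominators have no
  zeros on \<open>S\<close>.
\<close>

definition localization ::
  "(real ^ 'n) set \<Rightarrow> (real ^ 'n) set \<Rightarrow> (real ^ 'n \<Rightarrow> real) set \<Rightarrow> (real ^ 'n \<Rightarrow> real) set" where
  "localization X S A =
     {u \<in> extensional S. \<exists>s. denominator X s \<and> (\<lambda>x\<in>S. s x * u x) \<in> A}"

text \<open>
  The choice of the multiplier \<open>s\<close> is immaterial by \<open>extend_character_eq\<close> below.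
\<close>

definition extend_character ::
  "(real ^ 'n) set \<Rightarrow> (real ^ 'n) set \<Rightarrow> (real ^ 'n \<Rightarrow> real) set \<Rightarrow>
     ((real ^ 'n \<Rightarrow> real) \<Rightarrow> real) \<Rightarrow> (real ^ 'n \<Rightarrow> real) \<Rightarrow> real" where
  "extend_character X S A \<xi> u =
     (let s = SOME s. denominator X s \<and> (\<lambda>x\<in>S. s x * u x) \<in> A
      in \<xi> (\<lambda>x\<in>S. s x * u x) / \<xi> (restrict s S))"

locale algebra_over_polynomials =
  fixes X :: "(real ^ 'n) set" and S :: "(real ^ 'n) set" and A :: "(real ^ 'n \<Rightarrow> real) set"
  assumes algebraic: "real_algebraic_set X" and S_subset: "S \<subseteq> X"
    and A_extensional: "A \<subseteq> extensional S"
    and polynomials_in: "polynomials_on S \<subseteq> A"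
    and A_add: "u \<in> A \<Longrightarrow> v \<in> A \<Longrightarrow> (\<lambda>x\<in>S. u x + v x) \<in> A"
    and A_mult: "u \<in> A \<Longrightarrow> v \<in> A \<Longrightarrow> (\<lambda>x\<in>S. u x * v x) \<in> A"
begin

lemma polynomial_in: "real_polynomial_function p \<Longrightarrow> restrict p S \<in> A"
  using polynomials_in polynomials_onI by blast

lemma polynomial_mult_in:
  assumes "real_polynomial_function p" "u \<in> A" "\<And>x. x \<in> S \<Longrightarrow> v x = p x * u x"
  shows "(\<lambda>x\<in>S. v x) \<in> A"
    and "character S A \<xi> \<Longrightarrow> \<xi> (\<lambda>x\<in>S. v x) = \<xi> (restrict p S) * \<xi> u"
proof -
  have "(\<lambda>x\<in>S. v x) = (\<lambda>x\<in>S. restrict p S x * u x)"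
    by (rule restrict_ext) (simp add: assms(3))
  then show "(\<lambda>x\<in>S. v x) \<in> A"
    "character S A \<xi> \<Longrightarrow> \<xi> (\<lambda>x\<in>S. v x) = \<xi> (restrict p S) * \<xi> u"
    using A_mult[OF polynomial_in[OF assms(1)] assms(2)]
      character_mult[OF _ polynomial_in[OF assms(1)] assms(2)] by metis+
qed

text \<open>
  The value is \<open>s\<close> at a point of \<open>X\<close>, where \<open>s\<close> does not vanish.
\<close>

lemma character_denominator:
  assumes "character S A \<xi>" "denominator X s"
  shows "\<xi> (restrict s S) \<noteq> 0"
  using character_polynomial[OF assms(1) polynomials_in, of s]
    character_point_in[OF assms(1) polynomials_in algebraic S_subset] assms(2)
  unfolding denominator_def by simp

text \<open>
  Two multipliers \<open>s\<close> and \<open>t\<close> are compared through the value of the character at \<open>s \<cdot> t \<cdot> u\<close>.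
\<close>

lemma extend_character_eq:
  assumes ch: "character S A \<xi>" and s: "denominator X s" "(\<lambda>x\<in>S. s x * u x) \<in> A"
  shows "extend_character X S A \<xi> u = \<xi> (\<lambda>x\<in>S. s x * u x) / \<xi> (restrict s S)"
proof -
  define t where "t = (SOME s. denominator X s \<and> (\<lambda>x\<in>S. s x * u x) \<in> A)"
  have "\<exists>s. denominator X s \<and> (\<lambda>x\<in>S. s x * u x) \<in> A"
    using s by blast
  then have "denominator X t \<and> (\<lambda>x\<in>S. t x * u x) \<in> A"
    unfolding t_def by (rule someI_ex)
  then have t: "denominator X t" "(\<lambda>x\<in>S. t x * u x) \<in> A"
    by auto
  have polys: "real_polynomial_function s" "real_polynomial_function t"
    using s(1) t(1) unfolding denominator_def by auto
  have "\<xi> (restrict s S) * \<xi> (\<lambda>x\<in>S. t x * u x) = \<xi> (\<lambda>x\<in>S. s x * (t x * u x))"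
    by (rule polynomial_mult_in(2)[OF polys(1) t(2) _ ch, symmetric]) simp
  moreover have "\<xi> (restrict t S) * \<xi> (\<lambda>x\<in>S. s x * u x) = \<xi> (\<lambda>x\<in>S. s x * (t x * u x))"
    by (rule polynomial_mult_in(2)[OF polys(2) s(2) _ ch, symmetric]) simp
  ultimately have "\<xi> (restrict s S) * \<xi> (\<lambda>x\<in>S. t x * u x) = \<xi> (restrict t S) * \<xi> (\<lambda>x\<in>S. s x * u x)"
    by simp
  moreover have "\<xi> (restrict s S) \<noteq> 0" "\<xi> (restrict t S) \<noteq> 0"
    using character_denominator[OF ch] s(1) t(1) by auto
  ultimately show ?thesis
    unfolding extend_character_def Let_def t_def[symmetric] by (simp add: divide_simps mult.commute)
qed

lemma localizationE:
  assumes "u \<in> localization X S A"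
  obtains s where "denominator X s" "real_polynomial_function s" "(\<lambda>x\<in>S. s x * u x) \<in> A"
  using assms unfolding localization_def denominator_def by blast

lemma one_times: "a \<in> A \<Longrightarrow> (\<lambda>x\<in>S. 1 * a x) = a"
  using A_extensional by (simp add: extensional_restrict subset_iff)

lemma A_subset_localization: "A \<subseteq> localization X S A"
  unfolding localization_def using A_extensional denominator_one one_times by fastforce

lemma extend_character_on_A:
  assumes "character S A \<xi>" "a \<in> A"
  shows "extend_character X S A \<xi> a = \<xi> a"
  using extend_character_eq[OF assms(1) denominator_one, of a] assms(2)
  unfolding one_times[OF assms(2)] character_const[OF assms(1)] by simp

lemma character_extend:
  assumes ch: "character S A \<xi>"
  shows "character S (localization X S A) (extend_character X S A \<xi>)" (is "character S _ ?E")
proof -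
  have "?E (\<lambda>x\<in>S. u x + v x) = ?E u + ?E v \<and> ?E (\<lambda>x\<in>S. u x * v x) = ?E u * ?E v"
    if u: "u \<in> localization X S A" and v: "v \<in> localization X S A" for u v
  proof -
    obtain s where s: "denominator X s" "real_polynomial_function s" "(\<lambda>x\<in>S. s x * u x) \<in> A"
      using u by (rule localizationE)
    obtain t where t: "denominator X t" "real_polynomial_function t" "(\<lambda>x\<in>S. t x * v x) \<in> A"
      using v by (rule localizationE)
    define su where "su = (\<lambda>x\<in>S. s x * u x)"
    define tv where "tv = (\<lambda>x\<in>S. t x * v x)"
    have A: "su \<in> A" "tv \<in> A"
      using s(3) t(3) by (simp_all add: su_def tv_def)
    have st: "denominator X (\<lambda>x. s x * t x)"
      using s(1) t(1) by (rule denominator_mult)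
    have nz: "\<xi> (restrict s S) \<noteq> 0" "\<xi> (restrict t S) \<noteq> 0"
      using character_denominator[OF ch] s(1) t(1) by auto
    have st_eq: "\<xi> (\<lambda>x\<in>S. s x * t x) = \<xi> (restrict s S) * \<xi> (restrict t S)"
      by (rule polynomial_mult_in(2)[OF s(2) polynomial_in[OF t(2)] _ ch]) simp
    have Eu: "?E u = \<xi> su / \<xi> (restrict s S)" and Ev: "?E v = \<xi> tv / \<xi> (restrict t S)"
      using extend_character_eq[OF ch s(1,3)] extend_character_eq[OF ch t(1,3)]
      by (simp_all add: su_def tv_def)
    have prod: "(\<lambda>x\<in>S. (s x * t x) * (\<lambda>x\<in>S. u x * v x) x) = (\<lambda>x\<in>S. su x * tv x)"
      by (rule restrict_ext) (simp add: su_def tv_def)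
    have "?E (\<lambda>x\<in>S. u x * v x) = \<xi> (\<lambda>x\<in>S. su x * tv x) / \<xi> (\<lambda>x\<in>S. s x * t x)"
      using extend_character_eq[OF ch st, of "\<lambda>x\<in>S. u x * v x"] A_mult[OF A] unfolding prod by simp
    also have "\<dots> = ?E u * ?E v"
      unfolding Eu Ev character_mult[OF ch A] st_eq by simp
    finally have mult: "?E (\<lambda>x\<in>S. u x * v x) = ?E u * ?E v" .
    define tsu where "tsu = (\<lambda>x\<in>S. t x * su x)"
    define stv where "stv = (\<lambda>x\<in>S. s x * tv x)"
    have B: "tsu \<in> A" "\<xi> tsu = \<xi> (restrict t S) * \<xi> su" "stv \<in> A" "\<xi> stv = \<xi> (restrict s S) * \<xi> tv"
      unfolding tsu_def stv_def
      using polynomial_mult_in(1)[OF t(2) A(1)] polynomial_mult_in(2)[OF t(2) A(1) _ ch]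
        polynomial_mult_in(1)[OF s(2) A(2)] polynomial_mult_in(2)[OF s(2) A(2) _ ch] by simp_all
    have sum: "(\<lambda>x\<in>S. (s x * t x) * (\<lambda>x\<in>S. u x + v x) x) = (\<lambda>x\<in>S. tsu x + stv x)"
      by (rule restrict_ext) (simp add: su_def tv_def tsu_def stv_def algebra_simps)
    have "?E (\<lambda>x\<in>S. u x + v x) = \<xi> (\<lambda>x\<in>S. tsu x + stv x) / \<xi> (\<lambda>x\<in>S. s x * t x)"
      using extend_character_eq[OF ch st, of "\<lambda>x\<in>S. u x + v x"] A_add[OF B(1,3)] unfolding sum by simp
    also have "\<dots> = ?E u + ?E v"
      unfolding Eu Ev character_add[OF ch B(1,3)] B(2,4) st_eq using nz
      by (simp add: add_divide_distrib)
    finally show ?thesis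
      using mult by blast
  qed
  moreover have "?E (\<lambda>x\<in>S. c) = c" for c
    using extend_character_on_A[OF ch polynomial_in[OF real_polynomial_function.intros(2)[of c]]]
    unfolding character_const[OF ch] .
  ultimately show ?thesis
    unfolding character_def by blast
qed

end

section \<open>Algebraic sets with a given ring of polynomial functions\<close>

text \<open>
  The algebraic set \<open>Z\<close> is a model of the ring \<open>A\<close>: the isomorphism \<open>h\<close> identifies its polynomial
  functions with \<open>A\<close>. Evaluation at a point of \<open>Z\<close> becomes the character \<open>ev z\<close> of \<open>A\<close>.
\<close>

locale algebraic_model = algebra_over_polynomials X S A
  for X :: "(real ^ 'n) set" and S :: "(real ^ 'n) set" and A :: "(real ^ 'n \<Rightarrow> real) set" +
  fixes Z :: "(real ^ 'k) set" and h :: "(real ^ 'k \<Rightarrow> real) \<Rightarrow> (real ^ 'n \<Rightarrow> real)"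
  assumes Z_algebraic: "real_algebraic_set Z"
    and h_bij: "bij_betw h (polynomials_on Z) A"
    and h_add: "p \<in> polynomials_on Z \<Longrightarrow> q \<in> polynomials_on Z \<Longrightarrow>
      h (\<lambda>x\<in>Z. p x + q x) = (\<lambda>x\<in>S. h p x + h q x)"
    and h_mult: "p \<in> polynomials_on Z \<Longrightarrow> q \<in> polynomials_on Z \<Longrightarrow>
      h (\<lambda>x\<in>Z. p x * q x) = (\<lambda>x\<in>S. h p x * h q x)"
    and h_const: "h (\<lambda>x\<in>Z. c) = (\<lambda>x\<in>S. c)"
begin

definition ev :: "real ^ 'k \<Rightarrow> (real ^ 'n \<Rightarrow> real) \<Rightarrow> real" where
  "ev z a = inv_into (polynomials_on Z) h a z"

lemma h_in: "p \<in> polynomials_on Z \<Longrightarrow> h p \<in> A"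
  using h_bij by (rule bij_betw_apply)

lemma h_surj:
  assumes "a \<in> A"
  obtains p where "p \<in> polynomials_on Z" "a = h p"
  using assms h_bij unfolding bij_betw_def by blast

lemma ev_h: "p \<in> polynomials_on Z \<Longrightarrow> ev z (h p) = p z"
  using h_bij unfolding ev_def by (simp add: bij_betw_inv_into_left)

lemma character_ev:
  assumes z: "z \<in> Z"
  shows "character S A (ev z)"
  unfolding character_def
proof (intro conjI ballI allI)
  fix u v assume "u \<in> A" "v \<in> A"
  then obtain p q where p: "p \<in> polynomials_on Z" "u = h p" and q: "q \<in> polynomials_on Z" "v = h q"
    by (metis h_surj)
  show "ev z (\<lambda>x\<in>S. u x + v x) = ev z u + ev z v"
    using ev_h[OF polynomials_on_closed(1)[OF p(1) q(1)]] ev_h[OF p(1)] ev_h[OF q(1)] z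
    unfolding h_add[OF p(1) q(1)] p(2) q(2) by simp
  show "ev z (\<lambda>x\<in>S. u x * v x) = ev z u * ev z v"
    using ev_h[OF polynomials_on_closed(2)[OF p(1) q(1)]] ev_h[OF p(1)] ev_h[OF q(1)] z
    unfolding h_mult[OF p(1) q(1)] p(2) q(2) by simp
next
  fix c :: real
  show "ev z (\<lambda>x\<in>S. c) = c"
    using ev_h[OF polynomials_onI[OF real_polynomial_function.intros(2)[of c]]] z
    unfolding h_const by simp
qed

lemma ev_polynomial:
  assumes "a \<in> A"
  obtains p where "real_polynomial_function p" "\<And>z. z \<in> Z \<Longrightarrow> ev z a = p z"
proof -
  obtain q where q: "q \<in> polynomials_on Z" "a = h q"
    using assms by (rule h_surj)
  obtain p where "real_polynomial_function p" "q = restrict p Z"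
    using q(1) by (rule polynomials_onE)
  then show ?thesis
    using that[of p] ev_h[OF q(1)] q(2) by simp
qed

definition coordinate :: "'k \<Rightarrow> real ^ 'n \<Rightarrow> real" where
  "coordinate i = h (\<lambda>z\<in>Z. z $ i)"

lemma coordinate_polynomial: "(\<lambda>z\<in>Z. z $ i) \<in> polynomials_on Z"
  by (intro polynomials_onI real_polynomial_function.intros(1) bounded_linear_vec_nth)

lemma coordinate_in: "coordinate i \<in> A"
  unfolding coordinate_def by (intro h_in coordinate_polynomial)

lemma ev_coordinate: "z \<in> Z \<Longrightarrow> ev z (coordinate i) = z $ i"
  unfolding coordinate_def ev_h[OF coordinate_polynomial] by simp

lemma ev_inject:
  assumes "z \<in> Z" "z' \<in> Z" "\<And>a. a \<in> A \<Longrightarrow> ev z a = ev z' a"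
  shows "z = z'"
  using assms(3)[OF coordinate_in] assms(1,2) by (simp add: ev_coordinate vec_eq_iff)

text \<open>
  Transported to \<open>Z\<close>, the character is evaluation at a point, and the point lies in \<open>Z\<close> because \<open>Z\<close> is
  Zariski closed.
\<close>

lemma character_is_ev:
  assumes ch: "character S A \<xi>"
  obtains z where "z \<in> Z" "\<And>a. a \<in> A \<Longrightarrow> \<xi> a = ev z a"
proof -
  have ch': "character Z (polynomials_on Z) (\<lambda>p. \<xi> (h p))"
    unfolding character_def
    using h_add h_mult h_const character_add[OF ch] character_mult[OF ch] character_const[OF ch] h_in
    by simp
  define z where "z = (\<chi> j. \<xi> (h (\<lambda>x\<in>Z. x $ j)))"
  have z: "z \<in> Z"
    using character_point_in[OF ch' order_refl Z_algebraic order_refl] unfolding z_def .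
  have "\<xi> a = ev z a" if a: "a \<in> A" for a
  proof -
    obtain q where q: "q \<in> polynomials_on Z" "a = h q"
      using a by (rule h_surj)
    obtain p where p: "real_polynomial_function p" "q = restrict p Z"
      using q(1) by (rule polynomials_onE)
    have "\<xi> a = p z"
      using character_polynomial[OF ch' order_refl p(1)] unfolding q(2) p(2) z_def .
    then show ?thesis
      using ev_h[OF q(1), of z] q(2) p(2) z by simp
  qed
  then show ?thesis
    using that z by blast
qed

end

section \<open>Transport of models along a biregular isomorphism\<close>

text \<open>
  Pulling back an element of \<open>B\<close> introduces denominators, so that it ends up in the localization of \<open>A\<close>
  and in general not in \<open>A\<close>.
\<close>

locale model_pair =
  base: biregular_pair X Y f g + source: algebraic_model X S A Z h + target: algebraic_model Y T B W k
  for X :: "(real ^ 'n) set" and Y :: "(real ^ 'm) set" and f g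
    and S A and Z :: "(real ^ 'k) set" and h and T B and W :: "(real ^ 'l) set" and k +
  assumes f_S: "f ` S \<subseteq> T" and g_T: "g ` T \<subseteq> S"
    and pull_f: "b \<in> B \<Longrightarrow> (\<lambda>x\<in>S. b (f x)) \<in> localization X S A"
    and pull_g: "a \<in> A \<Longrightarrow> (\<lambda>y\<in>T. a (g y)) \<in> localization Y T B"
begin

lemma swap_models: "model_pair Y X g f T B W k S A Z h"
  by (intro model_pair.intro base.swap source.algebraic_model_axioms target.algebraic_model_axioms
      model_pair_axioms.intro f_S g_T pull_f pull_g)

text \<open>
  Write \<open>s \<circ> f = \<sigma> / \<tau>\<close> for a denominator \<open>s\<close> of \<open>u\<close>. The numerator \<open>\<sigma>\<close> has no zeros on \<open>X\<close> since \<open>s\<close>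
  has none on \<open>Y\<close>. If \<open>t\<close> is a denominator of \<open>b = (s \<cdot> u) \<circ> f\<close>, then \<open>t \<cdot> \<sigma>\<close> is one of \<open>u \<circ> f\<close>,
  because \<open>t \<cdot> \<sigma> \<cdot> (u \<circ> f) = \<tau> \<cdot> (t \<cdot> b)\<close>.
\<close>

lemma localization_pullback:
  assumes "u \<in> localization Y T B"
  shows "(\<lambda>x\<in>S. u (f x)) \<in> localization X S A"
proof -
  obtain s where s: "denominator Y s" "real_polynomial_function s" "(\<lambda>y\<in>T. s y * u y) \<in> B"
    using assms by (rule target.localizationE)
  obtain \<sigma> \<tau> where st: "real_polynomial_function \<sigma>" "real_polynomial_function \<tau>"
    "\<And>x. x \<in> X \<Longrightarrow> \<tau> x \<noteq> 0" "\<And>x. \<tau> x \<noteq> 0 \<Longrightarrow> s (f x) = \<sigma> x / \<tau> x"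
    using regular_near_polynomial_compose[OF base.f_regular s(2)] by (rule regular_nearE) blast
  have cross: "\<sigma> x = s (f x) * \<tau> x" if "x \<in> X" for x
    using st(3,4) that by simp
  define b where "b = (\<lambda>x\<in>S. (\<lambda>y\<in>T. s y * u y) (f x))"
  obtain t where t: "denominator X t" "real_polynomial_function t" "(\<lambda>x\<in>S. t x * b x) \<in> A"
    using pull_f[OF s(3)] unfolding b_def by (rule source.localizationE)
  have "\<sigma> x \<noteq> 0" if "x \<in> X" for x
    using cross[OF that] st(3)[OF that] s(1) base.f_in[OF that] unfolding denominator_def by auto
  then have "denominator X \<sigma>"
    using st(1) unfolding denominator_def by blast
  then have den: "denominator X (\<lambda>x. t x * \<sigma> x)"
    using t(1) by (intro denominator_mult)
  have "(\<lambda>x\<in>S. (t x * \<sigma> x) * (\<lambda>x\<in>S. u (f x)) x) \<in> A"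
  proof (rule source.polynomial_mult_in(1)[OF st(2) t(3)])
    fix x assume x: "x \<in> S"
    then have "f x \<in> T" "x \<in> X"
      using f_S source.S_subset by auto
    then show "t x * \<sigma> x * (\<lambda>x\<in>S. u (f x)) x = \<tau> x * (\<lambda>x\<in>S. t x * b x) x"
      using x cross by (simp add: b_def)
  qed
  then show ?thesis
    unfolding localization_def using den by auto
qed

text \<open>
  On \<open>B\<close>, pullback followed by the extended character of \<open>z\<close> is a character, hence evaluation at some
  \<open>w\<close>. Both sides are multiplicative on the localization of \<open>B\<close>, so they agree on fractions as well.
\<close>

lemma point_transport:
  assumes z: "z \<in> Z"
  obtains w where "w \<in> W"
    "\<And>u. u \<in> localization Y T B \<Longrightarrow>
       extend_character Y T B (target.ev w) u =
       extend_character X S A (source.ev z) (\<lambda>x\<in>S. u (f x))"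
proof -
  define E where "E = extend_character X S A (source.ev z)"
  have E: "character S (localization X S A) E"
    unfolding E_def using source.character_extend[OF source.character_ev[OF z]] .
  define P where "P u = (\<lambda>x\<in>S. u (f x))" for u :: "real ^ 'm \<Rightarrow> real"
  have P_add: "P (\<lambda>y\<in>T. u y + v y) = (\<lambda>x\<in>S. P u x + P v x)"
    and P_mult: "P (\<lambda>y\<in>T. u y * v y) = (\<lambda>x\<in>S. P u x * P v x)"
    and P_const: "P (\<lambda>y\<in>T. c) = (\<lambda>x\<in>S. c)" for u v c
    unfolding P_def by (rule restrict_ext; use f_S in auto)+
  have P_in: "P u \<in> localization X S A" if "u \<in> localization Y T B" for u
    unfolding P_def using localization_pullback[OF that] .
  have B_loc: "b \<in> localization Y T B" if "b \<in> B" for b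
    using target.A_subset_localization that by blast
  have "character T B (\<lambda>b. E (P b))"
    unfolding character_def P_add P_mult P_const
    using character_add[OF E] character_mult[OF E] character_const[OF E] P_in B_loc by simp
  then obtain w where w: "w \<in> W" and ev_w: "\<And>b. b \<in> B \<Longrightarrow> E (P b) = target.ev w b"
    by (rule target.character_is_ev) blast
  have ch_w: "character T B (target.ev w)"
    using w by (rule target.character_ev)
  have "extend_character Y T B (target.ev w) u = E (P u)" if u: "u \<in> localization Y T B" for u
  proof -
    obtain s where s: "denominator Y s" "real_polynomial_function s" "(\<lambda>y\<in>T. s y * u y) \<in> B"
      using u by (rule target.localizationE)
    have s_in: "restrict s T \<in> B"
      using s(2) by (rule target.polynomial_in)
    have eq: "(\<lambda>y\<in>T. s y * u y) = (\<lambda>y\<in>T. restrict s T y * u y)"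
      by (rule restrict_ext) simp
    have "target.ev w (\<lambda>y\<in>T. s y * u y) = E (P (\<lambda>y\<in>T. restrict s T y * u y))"
      using ev_w[OF s(3)] unfolding eq by simp
    also have "\<dots> = E (P (restrict s T)) * E (P u)"
      unfolding P_mult by (rule character_mult[OF E P_in[OF B_loc[OF s_in]] P_in[OF u]])
    also have "E (P (restrict s T)) = target.ev w (restrict s T)"
      using ev_w[OF s_in] .
    finally have numerator:
      "target.ev w (\<lambda>y\<in>T. s y * u y) = target.ev w (restrict s T) * E (P u)" .
    show ?thesis
      unfolding target.extend_character_eq[OF ch_w s(1,3)] numerator
      using target.character_denominator[OF ch_w s(1)] by simp
  qed
  then show ?thesis
    using that w unfolding E_def P_def by blast
qed

definition transport :: "real ^ 'k \<Rightarrow> real ^ 'l" where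
  "transport z = (SOME w. w \<in> W \<and> (\<forall>u\<in>localization Y T B.
     extend_character Y T B (target.ev w) u =
     extend_character X S A (source.ev z) (\<lambda>x\<in>S. u (f x))))"

lemma transport:
  assumes "z \<in> Z"
  shows "transport z \<in> W"
    and "u \<in> localization Y T B \<Longrightarrow>
       extend_character Y T B (target.ev (transport z)) u =
       extend_character X S A (source.ev z) (\<lambda>x\<in>S. u (f x))"
proof -
  have "\<exists>w. w \<in> W \<and> (\<forall>u\<in>localization Y T B.
     extend_character Y T B (target.ev w) u =
     extend_character X S A (source.ev z) (\<lambda>x\<in>S. u (f x)))"
    using point_transport[OF assms] by metis
  from someI_ex[OF this] show "transport z \<in> W"
    "u \<in> localization Y T B \<Longrightarrow>
       extend_character Y T B (target.ev (transport z)) u =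
       extend_character X S A (source.ev z) (\<lambda>x\<in>S. u (f x))"
    unfolding transport_def by blast+
qed

text \<open>
  The \<open>j\<close>-th coordinate of the image of \<open>z\<close> is the extended character of \<open>z\<close> at a pulled back element
  of \<open>B\<close>. A denominator \<open>s\<close> of this function can be chosen independently of \<open>z\<close>, and numerator and
  denominator are then polynomial functions of \<open>z\<close>.
\<close>

lemma transport_regular: "regular_on Z (\<lambda>z. transport z $ j)"
proof -
  let ?b = "target.coordinate j"
  have b: "?b \<in> B" "?b \<in> localization Y T B"
    using target.coordinate_in target.A_subset_localization by auto
  obtain s where s: "denominator X s" "real_polynomial_function s"
    "(\<lambda>x\<in>S. s x * (\<lambda>x\<in>S. ?b (f x)) x) \<in> A"
    using pull_f[OF b(1)] by (rule source.localizationE)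
  obtain p where p: "real_polynomial_function p"
    "\<And>z. z \<in> Z \<Longrightarrow> source.ev z (\<lambda>x\<in>S. s x * (\<lambda>x\<in>S. ?b (f x)) x) = p z"
    using s(3) by (rule source.ev_polynomial) blast
  obtain q where q: "real_polynomial_function q" "\<And>z. z \<in> Z \<Longrightarrow> source.ev z (restrict s S) = q z"
    using source.polynomial_in[OF s(2)] by (rule source.ev_polynomial) blast
  have "q z \<noteq> 0 \<and> transport z $ j = p z / q z" if z: "z \<in> Z" for z
  proof -
    have ch: "character S A (source.ev z)" and ch': "character T B (target.ev (transport z))"
      using source.character_ev[OF z] target.character_ev[OF transport(1)[OF z]] .
    have "transport z $ j = target.ev (transport z) ?b"
      using target.ev_coordinate[OF transport(1)[OF z]] by simp
    also have "\<dots> = extend_character X S A (source.ev z) (\<lambda>x\<in>S. ?b (f x))"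
      using target.extend_character_on_A[OF ch' b(1)] transport(2)[OF z b(2)] by simp
    also have "\<dots> = p z / q z"
      unfolding source.extend_character_eq[OF ch s(1,3)] p(2)[OF z] q(2)[OF z] ..
    finally show ?thesis
      using source.character_denominator[OF ch s(1)] q(2)[OF z] by simp
  qed
  then show ?thesis
    unfolding regular_on_def using p(1) q(1) by blast
qed

text \<open>
  Pulling back along \<open>g\<close> and then along \<open>f\<close> is the identity, so \<open>z\<close> and its image under both
  transports define the same character of \<open>A\<close>.
\<close>

lemma transport_inverse:
  assumes z: "z \<in> Z"
  shows "model_pair.transport Y X g T B W k S A Z h (transport z) = z"
proof -
  interpret reverse: model_pair Y X g f T B W k S A Z h
    by (rule swap_models)
  have w: "transport z \<in> W"
    using z by (rule transport(1))
  have "source.ev (reverse.transport (transport z)) a = source.ev z a" if a: "a \<in> A" for a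
  proof -
    have a_loc: "a \<in> localization X S A"
      using source.A_subset_localization a by blast
    have ch: "character S A (source.ev z)" "character S A (source.ev (reverse.transport (transport z)))"
      using source.character_ev z reverse.transport(1)[OF w] by auto
    have "(\<lambda>x\<in>S. (\<lambda>y\<in>T. a (g y)) (f x)) = (\<lambda>x\<in>S. a x)"
      by (rule restrict_ext) (use f_S base.gf source.S_subset in auto)
    also have "\<dots> = a"
      using a source.A_extensional by (simp add: extensional_restrict subset_iff)
    finally have pull: "(\<lambda>x\<in>S. (\<lambda>y\<in>T. a (g y)) (f x)) = a" .
    have "source.ev (reverse.transport (transport z)) a =
        extend_character Y T B (target.ev (transport z)) (\<lambda>y\<in>T. a (g y))"
      using source.extend_character_on_A[OF ch(2) a] reverse.transport(2)[OF w a_loc] by simp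
    also have "\<dots> = extend_character X S A (source.ev z) a"
      using transport(2)[OF z pull_g[OF a]] unfolding pull .
    also have "\<dots> = source.ev z a"
      using source.extend_character_on_A[OF ch(1) a] .
    finally show ?thesis .
  qed
  then show ?thesis
    using source.ev_inject[OF reverse.transport(1)[OF w] z] by blast
qed

lemma biregular_models: "biregular Z W"
proof -
  interpret reverse: model_pair Y X g f T B W k S A Z h
    by (rule swap_models)
  have bij: "bij_betw transport Z W"
    by (rule bij_betw_byWitness[where f' = reverse.transport])
      (use transport_inverse reverse.transport_inverse transport(1) reverse.transport(1) in auto)
  have inv: "inv_into Z transport w = reverse.transport w" if w: "w \<in> W" for w
  proof (rule inv_into_f_eq)
    show "inj_on transport Z"
      using bij by (rule bij_betw_imp_inj_on)
    show "reverse.transport w \<in> Z"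
      using w by (rule reverse.transport(1))
    show "transport (reverse.transport w) = w"
      using w by (rule reverse.transport_inverse)
  qed
  have "regular_on W (\<lambda>w. inv_into Z transport w $ j)" for j
    by (rule regular_on_cong[OF reverse.transport_regular]) (simp add: inv)
  then show ?thesis
    unfolding biregular_def using bij transport_regular by blast
qed

end

section \<open>Models of integral closures\<close>

lemma algebraic_model_integral_closure:
  fixes X :: "(real ^ 'n) set" and Z :: "(real ^ 'k) set"
  assumes X: "real_algebraic_set X" "S \<subseteq> X" and K: "function_algebra S K"
    and Z: "real_algebraic_set Z"
    and iso: "real_algebra_iso Z (poly_ring_of Z) S (integral_closure (polynomials_on S) (fun_ring S K))"
  obtains h where "algebraic_model X S {u \<in> K. integral_over_polynomials S u} Z h"
proof -
  interpret K: function_algebra S K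
    by (rule K)
  let ?A = "{u \<in> K. integral_over_polynomials S u}"
  let ?R = "integral_closure (polynomials_on S) (fun_ring S K)"
  obtain h where h: "h \<in> ring_iso (poly_ring_of Z) ?R" and const: "\<And>c::real. h (\<lambda>x\<in>Z. c) = (\<lambda>x\<in>S. c)"
    using iso unfolding real_algebra_iso_def by blast
  have carrier_Z: "carrier (poly_ring_of Z) = polynomials_on Z"
    by (simp add: poly_ring_of_def fun_ring_def)
  have bij: "bij_betw h (polynomials_on Z) ?A"
    using h unfolding ring_iso_def carrier_Z K.carrier_integral_closure by simp
  have hom: "h \<in> ring_hom (poly_ring_of Z) ?R"
    using h unfolding ring_iso_def by simp
  have h_add: "h (\<lambda>x\<in>Z. p x + q x) = (\<lambda>x\<in>S. h p x + h q x)"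
    if "p \<in> polynomials_on Z" "q \<in> polynomials_on Z" for p q
    using ring_hom_add[OF hom, unfolded carrier_Z, OF that]
    by (simp add: poly_ring_of_def fun_ring_def integral_closure_def)
  have h_mult: "h (\<lambda>x\<in>Z. p x * q x) = (\<lambda>x\<in>S. h p x * h q x)"
    if "p \<in> polynomials_on Z" "q \<in> polynomials_on Z" for p q
    using ring_hom_mult[OF hom, unfolded carrier_Z, OF that]
    by (simp add: poly_ring_of_def fun_ring_def integral_closure_def)
  \<comment> \<open>That sums and products of integral elements are integral is inherited from the polynomials on \<open>Z\<close> through \<open>h\<close>.\<close>
  have closed: "(\<lambda>x\<in>S. u x + v x) \<in> ?A \<and> (\<lambda>x\<in>S. u x * v x) \<in> ?A" if "u \<in> ?A" "v \<in> ?A" for u v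
  proof -
    obtain p where p: "p \<in> polynomials_on Z" "u = h p"
      using \<open>u \<in> ?A\<close> bij_betw_imp_surj_on[OF bij] by blast
    obtain q where q: "q \<in> polynomials_on Z" "v = h q"
      using \<open>v \<in> ?A\<close> bij_betw_imp_surj_on[OF bij] by blast
    show ?thesis
      using bij_betw_apply[OF bij polynomials_on_closed(1)[OF p(1) q(1)]]
        bij_betw_apply[OF bij polynomials_on_closed(2)[OF p(1) q(1)]]
      unfolding p(2) q(2) h_add[OF p(1) q(1)] h_mult[OF p(1) q(1)] by (rule conjI)
  qed
  have "polynomials_on S \<subseteq> ?A"
  proof
    fix u assume "u \<in> polynomials_on S"
    then obtain p where "real_polynomial_function p" "u = restrict p S"
      by (rule polynomials_onE)
    then show "u \<in> ?A"
      using K.polynomial integral_over_polynomials_polynomial[of p S u] by simp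
  qed
  then have "algebraic_model X S ?A Z h"
    using X Z bij h_add h_mult const closed K.extensional by unfold_locales auto
  then show ?thesis
    by (rule that)
qed

lemma (in biregular_pair) integral_pullback_in_localization:
  assumes K: "function_algebra S K" and S: "S \<subseteq> X" "f ` S \<subseteq> T"
    and pull: "\<And>u. u \<in> L \<Longrightarrow> (\<lambda>x\<in>S. u (f x)) \<in> K"
    and b: "b \<in> {u \<in> L. integral_over_polynomials T u}"
  shows "(\<lambda>x\<in>S. b (f x)) \<in> localization X S {u \<in> K. integral_over_polynomials S u}"
proof -
  interpret K: function_algebra S K
    by (rule K)
  obtain e where e: "real_polynomial_function e" "\<And>x. x \<in> X \<Longrightarrow> e x \<noteq> 0"
    and int: "integral_over_polynomials S (\<lambda>x\<in>S. e x * b (f x))"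
    using integral_pullback[OF _ S(2,1), of b] b by blast
  have eq: "(\<lambda>x\<in>S. e x * (\<lambda>x\<in>S. b (f x)) x) = (\<lambda>x\<in>S. e x * b (f x))"
    "(\<lambda>x\<in>S. restrict e S x * (\<lambda>x\<in>S. b (f x)) x) = (\<lambda>x\<in>S. e x * b (f x))"
    by (rule restrict_ext, simp)+
  have "(\<lambda>x\<in>S. e x * b (f x)) \<in> K"
    using K.mult_closed[OF K.polynomial[OF e(1)] pull[of b]] b unfolding eq by simp
  then have "(\<lambda>x\<in>S. e x * (\<lambda>x\<in>S. b (f x)) x) \<in> {u \<in> K. integral_over_polynomials S u}"
    unfolding eq using int by simp
  moreover have "denominator X e"
    using e unfolding denominator_def by blast
  ultimately show ?thesis
    unfolding localization_def by auto
qed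

lemma (in biregular_pair) biregular_integral_closures:
  fixes Z :: "(real ^ 'k) set" and W :: "(real ^ 'l) set"
  assumes K: "function_algebra S K" "S \<subseteq> X" and L: "function_algebra T L" "T \<subseteq> Y"
    and f_S: "f ` S \<subseteq> T" and g_T: "g ` T \<subseteq> S"
    and pull_f: "\<And>u. u \<in> L \<Longrightarrow> (\<lambda>x\<in>S. u (f x)) \<in> K"
    and pull_g: "\<And>u. u \<in> K \<Longrightarrow> (\<lambda>y\<in>T. u (g y)) \<in> L"
    and Z: "real_algebraic_set Z"
      "real_algebra_iso Z (poly_ring_of Z) S (integral_closure (polynomials_on S) (fun_ring S K))"
    and W: "real_algebraic_set W"
      "real_algebra_iso W (poly_ring_of W) T (integral_closure (polynomials_on T) (fun_ring T L))"
  shows "biregular Z W"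
proof -
  let ?A = "{u \<in> K. integral_over_polynomials S u}" and ?B = "{u \<in> L. integral_over_polynomials T u}"
  obtain h where h: "algebraic_model X S ?A Z h"
    using algebraic_X K(2,1) Z by (rule algebraic_model_integral_closure)
  obtain k where k: "algebraic_model Y T ?B W k"
    using algebraic_Y L(2,1) W by (rule algebraic_model_integral_closure)
  have "model_pair X Y f g S ?A Z h T ?B W k"
  proof (intro model_pair.intro model_pair_axioms.intro biregular_pair_axioms h k f_S g_T)
    show "(\<lambda>x\<in>S. b (f x)) \<in> localization X S ?A" if "b \<in> ?B" for b
      by (rule integral_pullback_in_localization[OF K(1,2) f_S pull_f that])
    show "(\<lambda>y\<in>T. a (g y)) \<in> localization Y T ?B" if "a \<in> ?A" for a
      by (rule biregular_pair.integral_pullback_in_localization[OF swap L(1,2) g_T pull_g that])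
  qed
  then show ?thesis
    by (rule model_pair.biregular_models)
qed

text \<open>
  The component functions are replaced by fractions with the same values on \<open>X\<close> and on \<open>Y\<close>.
\<close>

lemma biregular_obtains_pair:
  assumes "real_algebraic_set X" "real_algebraic_set Y" "biregular X Y"
  obtains f g where "biregular_pair X Y f g"
proof -
  obtain f where bij: "bij_betw f X Y" and f: "\<And>j. regular_on X (\<lambda>x. f x $ j)"
    and g: "\<And>i. regular_on Y (\<lambda>y. inv_into X f y $ i)"
    using assms(3) unfolding biregular_def by blast
  have "\<exists>\<phi>. regular_near X \<phi> \<and> (\<forall>x\<in>X. \<phi> x = f x $ j)" for j
    using f[of j] by (rule regular_on_imp_regular_near) blast
  then obtain \<phi> where \<phi>: "\<And>j. regular_near X (\<phi> j)" "\<And>j x. x \<in> X \<Longrightarrow> \<phi> j x = f x $ j"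
    by metis
  have "\<exists>\<psi>. regular_near Y \<psi> \<and> (\<forall>y\<in>Y. \<psi> y = inv_into X f y $ i)" for i
    using g[of i] by (rule regular_on_imp_regular_near) blast
  then obtain \<psi> where \<psi>: "\<And>i. regular_near Y (\<psi> i)" "\<And>i y. y \<in> Y \<Longrightarrow> \<psi> i y = inv_into X f y $ i"
    by metis
  have eq: "(\<chi> j. \<phi> j x) = f x" if "x \<in> X" for x
    using \<phi>(2)[OF that] by (simp add: vec_eq_iff)
  have eq': "(\<chi> i. \<psi> i y) = inv_into X f y" if "y \<in> Y" for y
    using \<psi>(2)[OF that] by (simp add: vec_eq_iff)
  have "biregular_pair X Y (\<lambda>x. \<chi> j. \<phi> j x) (\<lambda>y. \<chi> i. \<psi> i y)"
  proof
    fix x assume x: "x \<in> X"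
    then have fx: "f x \<in> Y"
      using bij by (metis bij_betw_apply)
    then show "(\<chi> j. \<phi> j x) \<in> Y"
      by (simp add: eq x)
    show "(\<chi> i. \<psi> i (\<chi> j. \<phi> j x)) = x"
      unfolding eq[OF x] eq'[OF fx] using bij x by (rule bij_betw_inv_into_left)
  next
    fix y assume y: "y \<in> Y"
    have gy: "inv_into X f y \<in> X"
      using bij_betw_inv_into[OF bij] y by (rule bij_betw_apply)
    then show "(\<chi> i. \<psi> i y) \<in> X"
      by (simp add: eq' y)
    show "(\<chi> j. \<phi> j (\<chi> i. \<psi> i y)) = y"
      unfolding eq'[OF y] eq[OF gy] using bij y by (rule bij_betw_inv_into_right)
  qed (simp_all add: assms \<phi>(1) \<psi>(1))
  then show ?thesis
    by (rule that)
qed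

lemma K0_Cent_fun_ring: "K0_Cent X = fun_ring (Cent X) (carrier (K0_Cent X))"
  unfolding K0_Cent_def by (simp add: fun_ring_def)

lemma R0_Cent_fun_ring: "R0_Cent X = fun_ring (Cent X) (carrier (R0_Cent X))"
  unfolding R0_Cent_def by (simp add: fun_ring_def)

theorem theorem4p22:
  fixes X :: "(real ^ 'n) set" and Y :: "(real ^ 'm) set"
    and Xw :: "(real ^ 'k) set" and Yw :: "(real ^ 'l) set"
    and Xs :: "(real ^ 'p) set" and Ys :: "(real ^ 'q) set"
  assumes "real_algebraic_set X" and "real_algebraic_set Y"
    and "biregular X Y"
  shows "(is_central_weak_normalization X Xw \<and> is_central_weak_normalization Y Yw
            \<longrightarrow> biregular Xw Yw) \<and>
         (is_central_seminormalization X Xs \<and> is_central_seminormalization Y Ys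
            \<longrightarrow> biregular Xs Ys)"
proof -
  obtain f g where "biregular_pair X Y f g"
    using assms by (rule biregular_obtains_pair)
  then interpret biregular_pair X Y f g .
  note Cent_images = Cent_image_subset biregular_pair.Cent_image_subset[OF swap]
  show ?thesis
  proof (intro conjI impI; elim conjE)
    assume w: "is_central_weak_normalization X Xw" "is_central_weak_normalization Y Yw"
    show "biregular Xw Yw"
      using w K0_Cent_fun_ring[of X] K0_Cent_fun_ring[of Y]
      unfolding is_central_weak_normalization_def
      by (intro biregular_integral_closures[OF function_algebra_K0_Cent Cent_subset
            function_algebra_K0_Cent Cent_subset Cent_images K0_Cent_pullback
            biregular_pair.K0_Cent_pullback[OF swap]]) simp_all
  next
    assume s: "is_central_seminormalization X Xs" "is_central_seminormalization Y Ys"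
    show "biregular Xs Ys"
      using s R0_Cent_fun_ring[of X] R0_Cent_fun_ring[of Y]
      unfolding is_central_seminormalization_def
      by (intro biregular_integral_closures[OF function_algebra_R0_Cent Cent_subset
            function_algebra_R0_Cent Cent_subset Cent_images R0_Cent_pullback
            biregular_pair.R0_Cent_pullback[OF swap]]) simp_all
  qed
qed

end
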